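(* Let $\Gamma$ be any finitely generated countably infinite amenable group with a finite symmetric generating set $S$ not containing the identity. Let $\mathcal{G}$ be the Schreier graph (with respect to $S$) induced by the free part of the shift action $\Gamma\curvearrowright\omega^\Gamma$. Then $D_B(\mathcal{G})=\omega$ (i.e. $D_B(\mathcal{G})=\aleph_0$).
   Context: Here $\omega$ is the countably infinite discrete alphabet and $\omega^\Gamma$ carries the product Borel structure. The shift action is $(g\cdot x)(h)=x(hg)$. The free part is $X=\{x\in \omega^\Gamma : g\cdot x\neq x \text{ for all } g\in\Gamma\setminus\{e\}\}$, where $e$ is the identity. The Schreier graph $\mathcal{G}=(X,E)$ has vertex set $X$ and edges $x\,E\,y \iff x\neq y$ and $s\cdot x=y$ for some $s\in S$. $\Gamma$ is amenable if there is a sequence of non-empty finite sets $F_m\subseteq\Gamma$ with $|gF_m\triangle F_m|/|F_m|\to 0$ for every $g\in\Gamma$. For a Borel graph $\mathcal{G}=(X,E)$ ($X$ a standard Borel space, $E\subseteq X\times X$ Borel, symmetric, irreflexive), a Borel distinguishing $Y$-coloring is a Borel map $c:X\to Y$ into a standard Borel space $Y$ such that $c\circ\psi\neq c$ for every non-identity graph automorphism $\psi$ of $\mathcal{G}$ (not necessarily Borel). The Borel distinguishing number $D_B(\mathcal{G})$ is the minimum cardinality $|Y|$ of a standard Borel space $Y$ for which a Borel distinguishing $Y$-coloring exists. *)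

theory Defs
  imports "HOL-Analysis.Analysis" "HOL-Algebra.Algebra"
begin

no_notation elt_set_eq (infix \<open>=o\<close> 50)
unbundle cardinal_syntax

section \<open>Amenable groups\<close>

definition amenable :: "('g, 'm) monoid_scheme \<Rightarrow> bool" where
  "amenable G \<longleftrightarrow>
     (\<exists>F :: nat \<Rightarrow> 'g set.
        (\<forall>m. F m \<subseteq> carrier G \<and> finite (F m) \<and> F m \<noteq> {}) \<and>
        (\<forall>g \<in> carrier G.
           (\<lambda>m. real (card (sym_diff (g <#\<^bsub>G\<^esub> F m) (F m))) / real (card (F m))) \<longlonglongrightarrow> 0))"


section \<open>Standard Borel spaces and Borel graphs\<close>

text \<open>Only the underlying \<open>\<sigma>\<close>-algebra of a \<^typ>\<open>'a measure\<close> is used.\<close>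

definition standard_borel :: "'a measure \<Rightarrow> bool" where
  "standard_borel M \<longleftrightarrow>
     (\<exists>T. completely_metrizable_space T \<and> second_countable T \<and>
          topspace T = space M \<and> sets M = sigma_sets (topspace T) {U. openin T U})"

definition borel_graph :: "'a measure \<Rightarrow> ('a \<times> 'a) set \<Rightarrow> bool" where
  "borel_graph M E \<longleftrightarrow>
     standard_borel M \<and> E \<in> sets (M \<Otimes>\<^sub>M M) \<and> sym E \<and> irrefl E"

definition graph_automorphism :: "'a set \<Rightarrow> ('a \<times> 'a) set \<Rightarrow> ('a \<Rightarrow> 'a) \<Rightarrow> bool" where
  "graph_automorphism V E \<psi> \<longleftrightarrow>
     bij_betw \<psi> V V \<and> (\<forall>x \<in> V. \<forall>y \<in> V. (\<psi> x, \<psi> y) \<in> E \<longleftrightarrow> (x, y) \<in> E)"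

text \<open>Maps on the vertex set are compared on that set only.\<close>

definition borel_distinguishing_coloring ::
    "'a measure \<Rightarrow> ('a \<times> 'a) set \<Rightarrow> 'y measure \<Rightarrow> ('a \<Rightarrow> 'y) \<Rightarrow> bool" where
  "borel_distinguishing_coloring M E Y c \<longleftrightarrow>
     standard_borel Y \<and> c \<in> M \<rightarrow>\<^sub>M Y \<and>
     (\<forall>\<psi>. graph_automorphism (space M) E \<psi> \<and> (\<exists>x \<in> space M. \<psi> x \<noteq> x) \<longrightarrow>
          (\<exists>x \<in> space M. c (\<psi> x) \<noteq> c x))"

text \<open>
  The colour spaces range over all standard Borel structures (not just the usual one) on
  all sets of reals. Nothing is lost, as every standard Borel space is isomorphic to one of
  these; see \<open>distinguishing_cardinals_of_coloring\<close> and \<open>borel_distinguishing_number_le\<close>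
  below. For a Borel graph the set of cardinals is non-empty, so that \<open>SOME\<close> picks its minimum
  (\<open>borel_distinguishing_number_attained\<close>). The minimum is unique only up to \<open>=o\<close>.
\<close>

definition distinguishing_cardinals :: "'a measure \<Rightarrow> ('a \<times> 'a) set \<Rightarrow> real rel set" where
  "distinguishing_cardinals M E =
     {|space Y| | (Y :: real measure) c. borel_distinguishing_coloring M E Y c}"

definition borel_distinguishing_number :: "'a measure \<Rightarrow> ('a \<times> 'a) set \<Rightarrow> real rel" where
  "borel_distinguishing_number M E =
     (SOME \<kappa>. \<kappa> \<in> distinguishing_cardinals M E \<and>
             (\<forall>\<kappa>' \<in> distinguishing_cardinals M E. \<kappa> \<le>o \<kappa>'))"

lemma standard_borel_lepoll_reals:
  assumes "standard_borel M"
  shows "space M \<lesssim> (UNIV :: real set)"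
proof -
  obtain T where T: "completely_metrizable_space T" "second_countable T" "topspace T = space M"
    using assms unfolding standard_borel_def by blast
  obtain B where B: "countable B" "\<forall>V \<in> B. openin T V"
      "\<forall>U x. openin T U \<and> x \<in> U \<longrightarrow> (\<exists>V \<in> B. x \<in> V \<and> V \<subseteq> U)"
    using T(2) unfolding second_countable_def by blast
  have t0: "t0_space T"
    by (simp add: T(1) completely_metrizable_imp_metrizable_space metrizable_imp_t1_space
        t1_imp_t0_space)
  define F where "F x = to_nat_on B ` {V \<in> B. x \<in> V}" for x
  have "inj_on F (space M)"
  proof (rule inj_onI, rule ccontr)
    fix x y assume xy: "x \<in> space M" "y \<in> space M" "F x = F y" "x \<noteq> y"
    have inj: "inj_on (to_nat_on B) B" using B(1) by auto
    have eq: "{V \<in> B. x \<in> V} = {V \<in> B. y \<in> V}"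
      using xy(3) inj_on_image_eq_iff[OF inj, of "{V \<in> B. x \<in> V}" "{V \<in> B. y \<in> V}"]
      unfolding F_def by auto
    obtain U where "openin T U" "(x \<in> U) \<noteq> (y \<in> U)"
      using t0 xy T(3) unfolding t0_space_def by metis
    then show False using B(3) eq by blast
  qed
  then have "space M \<lesssim> (UNIV :: nat set set)"
    unfolding lepoll_def by blast
  then show ?thesis
    using nat_sets_eqpoll_reals lepoll_trans eqpoll_imp_lepoll by blast
qed

lemma standard_borel_vimage_algebra:
  assumes "standard_borel M" and g: "bij_betw g A (space M)"
  shows "standard_borel (vimage_algebra A g M)"
proof -
  obtain T where T: "completely_metrizable_space T" "second_countable T" "topspace T = space M"
      "sets M = sigma_sets (topspace T) {U. openin T U}"
    using assms unfolding standard_borel_def by blast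
  define T' where "T' = pullback_topology A g T"
  have gA: "g \<in> A \<rightarrow> space M" using g by (auto simp: bij_betw_def)
  have top': "topspace T' = A"
    using gA T(3) by (auto simp: T'_def topspace_pullback_topology)
  have op': "openin T' U \<longleftrightarrow> (\<exists>V. openin T V \<and> U = g -` V \<inter> A)" for U
    unfolding T'_def by (rule openin_pullback_topology)
  have im: "g ` (g -` V \<inter> A) = V" if "V \<subseteq> space M" for V
  proof -
    have "V \<subseteq> g ` A" using that g by (simp add: bij_betw_def)
    then show ?thesis by (auto simp: subset_iff)
  qed
  have "homeomorphic_map T' T g"
  proof (rule bijective_open_imp_homeomorphic_map)
    show "continuous_map T' T g"
      unfolding T'_def by (rule continuous_map_pullback[OF continuous_map_id, simplified])
    show "open_map T' T g"
      unfolding open_map_def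
    proof (intro allI impI)
      fix U assume "openin T' U"
      then obtain V where V: "openin T V" "U = g -` V \<inter> A" by (auto simp: op')
      then have "V \<subseteq> space M" using openin_subset[OF V(1)] T(3) by simp
      then show "openin T (g ` U)" using im V by simp
    qed
    show "g ` topspace T' = topspace T" "inj_on g (topspace T')"
      using g by (auto simp: top' T(3) bij_betw_def)
  qed
  then have "T' homeomorphic_space T"
    using homeomorphic_map_imp_homeomorphic_space by blast
  then have "completely_metrizable_space T'" "second_countable T'"
    by (simp_all add: T homeomorphic_completely_metrizable_space homeomorphic_space_second_countability)
  moreover have "sets (vimage_algebra A g M) = sigma_sets A {U. openin T' U}"
  proof -
    have "sets (vimage_algebra A g M) = {g -` S \<inter> A | S. S \<in> sigma_sets (space M) {U. openin T U}}"
      using sets_vimage_algebra2[OF gA] T by simp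
    also have "\<dots> = sigma_sets A {g -` S \<inter> A | S. S \<in> {U. openin T U}}"
      by (rule sigma_sets_vimage_commute[OF gA])
    also have "{g -` S \<inter> A | S. S \<in> {U. openin T U}} = {U. openin T' U}"
      by (auto simp: op')
    finally show ?thesis .
  qed
  ultimately show ?thesis
    unfolding standard_borel_def using top' by (intro exI[of _ T']) simp
qed

lemma standard_borel_restrict_gdelta:
  assumes T: "completely_metrizable_space T" "second_countable T" "topspace T = space M"
      "sets M = sigma_sets (topspace T) {U. openin T U}"
    and P: "gdelta_in T P"
  shows "standard_borel (restrict_space M P)"
  unfolding standard_borel_def
proof (intro exI[of _ "subtopology T P"] conjI)
  have sub: "P \<subseteq> space M" using P T(3) gdelta_in_subset by metis
  show "completely_metrizable_space (subtopology T P)" "second_countable (subtopology T P)"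
    using T P completely_metrizable_space_gdelta_in second_countable_subtopology by auto
  show top: "topspace (subtopology T P) = space (restrict_space M P)"
    using T(3) by (simp add: space_restrict_space Int_commute)
  have "sets (restrict_space M P) = (\<inter>) P ` sigma_sets (space M) {U. openin T U}"
    using T by (simp add: sets_restrict_space)
  also have "\<dots> = sigma_sets P ((\<inter>) P ` {U. openin T U})"
  proof (rule sigma_sets_Int)
    have "P \<in> sigma_sets (space M) {U. openin T U}"
    proof -
      obtain \<U> where U: "countable \<U>" "\<And>U. U \<in> \<U> \<Longrightarrow> openin T U" "\<Inter>\<U> = P"
        using P unfolding gdelta_in_alt intersection_of_def by auto
      have "P = (\<Inter>U \<in> insert (space M) \<U>. U)" using U sub by auto
      moreover have "(\<Inter>U \<in> insert (space M) \<U>. U) \<in> sets M"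
        using U T by (intro sets.countable_INT') (auto intro: sigma_sets.Basic)
      ultimately show ?thesis using T by simp
    qed
    then show "P \<in> sigma_sets (space M) {U. openin T U}" .
  qed (use sub in auto)
  also have "(\<inter>) P ` {U. openin T U} = {U. openin (subtopology T P) U}"
    by (auto simp: openin_subtopology)
  finally show "sets (restrict_space M P) =
      sigma_sets (topspace (subtopology T P)) {U. openin (subtopology T P) U}"
    using sub T(3) by (simp add: Int_absorb1)
qed

lemma distinguishing_cardinals_of_coloring:
  fixes Y :: "'y measure"
  assumes c: "borel_distinguishing_coloring M E Y c"
  shows "\<exists>\<kappa> \<in> distinguishing_cardinals M E. \<kappa> =o |space Y|"
proof -
  have Y: "standard_borel Y" "c \<in> M \<rightarrow>\<^sub>M Y"
    using c unfolding borel_distinguishing_coloring_def by auto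
  obtain f :: "'y \<Rightarrow> real" where f: "inj_on f (space Y)"
    using standard_borel_lepoll_reals[OF Y(1)] unfolding lepoll_def by blast
  define g where "g = inv_into (space Y) f"
  define Z where "Z = vimage_algebra (f ` space Y) g Y"
  have g: "bij_betw g (f ` space Y) (space Y)"
    unfolding g_def by (rule bij_betw_inv_into) (simp add: f bij_betw_def)
  have fm: "f \<in> Y \<rightarrow>\<^sub>M Z"
    unfolding Z_def
  proof (rule measurable_vimage_algebra2)
    have "(\<lambda>x. g (f x)) \<in> Y \<rightarrow>\<^sub>M Y \<longleftrightarrow> (\<lambda>x. x) \<in> Y \<rightarrow>\<^sub>M Y"
      by (rule measurable_cong) (simp add: g_def f)
    then show "(\<lambda>x. g (f x)) \<in> Y \<rightarrow>\<^sub>M Y" by simp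
  qed auto
  have "borel_distinguishing_coloring M E Z (f \<circ> c)"
    unfolding borel_distinguishing_coloring_def
  proof (intro conjI allI impI)
    show "standard_borel Z"
      unfolding Z_def by (rule standard_borel_vimage_algebra[OF Y(1) g])
    show "f \<circ> c \<in> M \<rightarrow>\<^sub>M Z" using measurable_comp[OF Y(2) fm] .
    fix \<psi> assume \<psi>: "graph_automorphism (space M) E \<psi> \<and> (\<exists>x \<in> space M. \<psi> x \<noteq> x)"
    then obtain x where x: "x \<in> space M" "c (\<psi> x) \<noteq> c x"
      using c unfolding borel_distinguishing_coloring_def by blast
    have "\<psi> x \<in> space M"
      using \<psi> x(1) by (auto simp: graph_automorphism_def bij_betw_def)
    then have "(f \<circ> c) (\<psi> x) \<noteq> (f \<circ> c) x"
      using x f measurable_space[OF Y(2)] by (auto simp: inj_on_eq_iff)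
    then show "\<exists>x \<in> space M. (f \<circ> c) (\<psi> x) \<noteq> (f \<circ> c) x" using x(1) by blast
  qed
  then have "|space Z| \<in> distinguishing_cardinals M E"
    unfolding distinguishing_cardinals_def by blast
  moreover have "|space Z| =o |space Y|"
    using g unfolding Z_def by (auto intro: card_of_ordIsoI)
  ultimately show ?thesis by blast
qed

lemma borel_distinguishing_number_minimum:
  assumes "distinguishing_cardinals M E \<noteq> {}"
  shows "borel_distinguishing_number M E \<in> distinguishing_cardinals M E"
    and "\<kappa> \<in> distinguishing_cardinals M E \<Longrightarrow> borel_distinguishing_number M E \<le>o \<kappa>"
proof -
  have "\<forall>r \<in> distinguishing_cardinals M E. Card_order r"
    by (auto simp: distinguishing_cardinals_def card_of_Card_order)
  then have "\<exists>\<kappa>. \<kappa> \<in> distinguishing_cardinals M E \<and>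
      (\<forall>\<kappa>' \<in> distinguishing_cardinals M E. \<kappa> \<le>o \<kappa>')"
    using exists_minim_Card_order[OF assms] by blast
  from someI_ex[OF this] show
    "borel_distinguishing_number M E \<in> distinguishing_cardinals M E"
    "\<kappa> \<in> distinguishing_cardinals M E \<Longrightarrow> borel_distinguishing_number M E \<le>o \<kappa>"
    unfolding borel_distinguishing_number_def by blast+
qed

lemma borel_distinguishing_number_le:
  fixes Y :: "'y measure"
  assumes "borel_distinguishing_coloring M E Y c"
  shows "borel_distinguishing_number M E \<le>o |space Y|"
  using distinguishing_cardinals_of_coloring[OF assms] borel_distinguishing_number_minimum(2)
    ordLeq_ordIso_trans by fastforce

lemma borel_distinguishing_number_attained:
  assumes "borel_graph M E"
  shows "borel_distinguishing_number M E \<in> distinguishing_cardinals M E"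
proof -
  have "borel_distinguishing_coloring M E M (\<lambda>x. x)"
    using assms by (auto simp: borel_distinguishing_coloring_def borel_graph_def)
  then show ?thesis
    using distinguishing_cardinals_of_coloring borel_distinguishing_number_minimum(1) by blast
qed


section \<open>The free part of the shift and its Schreier graph\<close>

text \<open>
  For a countable group the product \<open>\<sigma>\<close>-algebra is the Borel \<open>\<sigma>\<close>-algebra of the product
  topology. Points are functions that are \<^const>\<open>undefined\<close> off the carrier.
\<close>

definition shift_space :: "('g, 'm) monoid_scheme \<Rightarrow> ('g \<Rightarrow> nat) measure" where
  "shift_space G = (\<Pi>\<^sub>M h \<in> carrier G. count_space (UNIV :: nat set))"

definition shift :: "('g, 'm) monoid_scheme \<Rightarrow> 'g \<Rightarrow> ('g \<Rightarrow> nat) \<Rightarrow> ('g \<Rightarrow> nat)" where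
  "shift G g x = (\<lambda>h \<in> carrier G. x (h \<otimes>\<^bsub>G\<^esub> g))"

definition free_part :: "('g, 'm) monoid_scheme \<Rightarrow> ('g \<Rightarrow> nat) set" where
  "free_part G = {x \<in> space (shift_space G). \<forall>g \<in> carrier G - {\<one>\<^bsub>G\<^esub>}. shift G g x \<noteq> x}"

definition free_shift :: "('g, 'm) monoid_scheme \<Rightarrow> ('g \<Rightarrow> nat) measure" where
  "free_shift G = restrict_space (shift_space G) (free_part G)"

definition schreier_graph ::
    "('g, 'm) monoid_scheme \<Rightarrow> 'g set \<Rightarrow> (('g \<Rightarrow> nat) \<times> ('g \<Rightarrow> nat)) set" where
  "schreier_graph G S =
     {(x, y). x \<in> free_part G \<and> y \<in> free_part G \<and> x \<noteq> y \<and> (\<exists>s \<in> S. shift G s x = y)}"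

lemma standard_borel_free_shift:
  fixes G :: "('g, 'm) monoid_scheme"
  assumes "group G" "countable (carrier G)"
  shows "standard_borel (free_shift G)"
proof -
  define I where "I = carrier G"
  define T where "T = product_topology (\<lambda>_ :: 'g. discrete_topology (UNIV :: nat set)) I"
  have I: "countable I" using assms by (simp add: I_def)
  have closed: "h \<otimes>\<^bsub>G\<^esub> g \<in> I" if "h \<in> I" "g \<in> I" for g h
    using that assms(1) by (simp add: I_def group.is_monoid monoid.m_closed)
  have top: "topspace T = (\<Pi>\<^sub>E i \<in> I. UNIV)" by (simp add: T_def)
  have sp: "space (shift_space G) = (\<Pi>\<^sub>E i \<in> I. UNIV)"
    by (simp add: shift_space_def space_PiM I_def)
  have cm: "completely_metrizable_space T"
    unfolding T_def completely_metrizable_space_product_topology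
    using I by (auto simp: completely_metrizable_space_discrete_topology intro: countable_subset)
  have coord_op: "openin T {x \<in> topspace T. x i \<in> A}" if "i \<in> I" for i A
    unfolding T_def
    by (rule openin_continuous_map_preimage[OF continuous_map_product_projection[OF that]]) simp
  have coord_meas: "{x \<in> topspace T. x i \<in> A} \<in> sets (shift_space G)" if "i \<in> I" for i A
  proof -
    have "(\<lambda>x. x i) \<in> shift_space G \<rightarrow>\<^sub>M count_space UNIV"
      unfolding shift_space_def using that I_def by (intro measurable_component_singleton) auto
    from measurable_sets[OF this, of A] show ?thesis
      by (simp add: sp top vimage_def Int_def conj_commute)
  qed
  define C where "C ps = topspace T \<inter> (\<Inter>p \<in> set ps. {x \<in> topspace T. x (fst p) \<in> {snd p}})"
    for ps :: "('g \<times> nat) list"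
  define B where "B = C ` lists (I \<times> UNIV)"
  have B: "countable B" unfolding B_def using I by (intro countable_image countable_lists) auto
  have Bop: "openin T (C ps)" and Bm: "C ps \<in> sets (shift_space G)"
    if "ps \<in> lists (I \<times> UNIV)" for ps
  proof -
    show "openin T (C ps)" using that
    proof (induction ps)
      case (Cons p ps)
      have "C (p # ps) = {x \<in> topspace T. x (fst p) \<in> {snd p}} \<inter> C ps" by (auto simp: C_def)
      then show ?case using Cons coord_op[of "fst p" "{snd p}"] by (auto intro!: openin_Int)
    qed (simp add: C_def)
    show "C ps \<in> sets (shift_space G)" using that
    proof (induction ps)
      case Nil
      then show ?case using sets.top[of "shift_space G"] by (simp add: C_def sp top)
    next
      case (Cons p ps)
      have "C (p # ps) = {x \<in> topspace T. x (fst p) \<in> {snd p}} \<inter> C ps" by (auto simp: C_def)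
      then show ?case using Cons coord_meas[of "fst p" "{snd p}"] by (auto intro!: sets.Int)
    qed
  qed
  have base: "\<exists>V \<in> B. x \<in> V \<and> V \<subseteq> U" if U: "openin T U" "x \<in> U" for U x
  proof -
    obtain Z where Z: "finite {i \<in> I. Z i \<noteq> UNIV}" "x \<in> Pi\<^sub>E I Z" "Pi\<^sub>E I Z \<subseteq> U"
      using U unfolding T_def openin_product_topology_alt by auto
    obtain js where js: "set js = {i \<in> I. Z i \<noteq> UNIV}" using finite_list[OF Z(1)] by blast
    let ?ps = "map (\<lambda>i. (i, x i)) js"
    have "C ?ps \<subseteq> Pi\<^sub>E I Z"
    proof
      fix y assume y: "y \<in> C ?ps"
      have "y i \<in> Z i" if "i \<in> I" for i
        using y Z(2) js that by (cases "Z i = UNIV") (auto simp: C_def)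
      then show "y \<in> Pi\<^sub>E I Z" using y by (auto simp: C_def top PiE_def)
    qed
    moreover have "x \<in> C ?ps" using openin_subset[OF U(1)] U(2) by (auto simp: C_def)
    moreover have "?ps \<in> lists (I \<times> UNIV)" by (simp add: in_lists_conv_set js)
    then have "C ?ps \<in> B" unfolding B_def by (rule imageI)
    ultimately show ?thesis using Z(3) by (meson subset_trans)
  qed
  have sc: "second_countable T"
    unfolding second_countable_def using B base Bop by (intro exI[of _ B]) (auto simp: B_def)
  have sets: "sets (shift_space G) = sigma_sets (topspace T) {U. openin T U}"
  proof
    have "sets (shift_space G) =
        sigma_sets (topspace T) {{f \<in> topspace T. f i \<in> A} | i A. i \<in> I}"
      by (simp add: shift_space_def sets_PiM_single I_def top)
    also have "\<dots> \<subseteq> sigma_sets (topspace T) {U. openin T U}"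
      by (rule sigma_sets_mono') (use coord_op in blast)
    finally show "sets (shift_space G) \<subseteq> sigma_sets (topspace T) {U. openin T U}" .
    show "sigma_sets (topspace T) {U. openin T U} \<subseteq> sets (shift_space G)"
      unfolding top sp[symmetric]
    proof (rule sets.sigma_sets_subset, rule subsetI)
      fix U assume "U \<in> {U. openin T U}"
      then have "U = \<Union>{V \<in> B. V \<subseteq> U}" using base by blast
      moreover have "\<Union>{V \<in> B. V \<subseteq> U} \<in> sets (shift_space G)"
        using B Bm by (intro sets.countable_Union) (auto simp: B_def intro: countable_subset)
      ultimately show "U \<in> sets (shift_space G)" by simp
    qed
  qed
  have "gdelta_in T (free_part G)"
  proof -
    define N where "N g = (\<Union>h \<in> {h \<in> I. h \<otimes>\<^bsub>G\<^esub> g \<in> I}.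
        \<Union>n. {x \<in> topspace T. x (h \<otimes>\<^bsub>G\<^esub> g) \<in> {n}} \<inter> {x \<in> topspace T. x h \<in> - {n}})" for g
    have Nop: "openin T (N g)" for g
    proof -
      have 1: "openin T ({x \<in> topspace T. x (h \<otimes>\<^bsub>G\<^esub> g) \<in> {n}} \<inter> {x \<in> topspace T. x h \<in> - {n}})"
        if "h \<in> I" "h \<otimes>\<^bsub>G\<^esub> g \<in> I" for h n
        using that by (intro openin_Int coord_op)
      have "openin T (\<Union>n. {x \<in> topspace T. x (h \<otimes>\<^bsub>G\<^esub> g) \<in> {n}} \<inter> {x \<in> topspace T. x h \<in> - {n}})"
        if "h \<in> I" "h \<otimes>\<^bsub>G\<^esub> g \<in> I" for h
        by (rule openin_Union) (use 1[OF that] in blast)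
      then show ?thesis
        unfolding N_def by (intro openin_Union) blast
    qed
    have "x \<in> N g \<longleftrightarrow> shift G g x \<noteq> x" if "x \<in> topspace T" "g \<in> I" for x g
    proof -
      have "shift G g x = x \<longleftrightarrow> (\<forall>h \<in> I. x (h \<otimes>\<^bsub>G\<^esub> g) = x h)"
        using that(1) unfolding shift_def I_def[symmetric] top
        by (auto simp: fun_eq_iff restrict_def PiE_iff extensional_def)
      then show ?thesis using that closed unfolding N_def by auto
    qed
    then have "free_part G = (\<Inter>g \<in> insert \<one>\<^bsub>G\<^esub> (I - {\<one>\<^bsub>G\<^esub>}).
        if g = \<one>\<^bsub>G\<^esub> then topspace T else N g)"
      by (auto simp: free_part_def sp top I_def)
    moreover have "gdelta_in T (\<Inter>g \<in> insert \<one>\<^bsub>G\<^esub> (I - {\<one>\<^bsub>G\<^esub>}).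
        if g = \<one>\<^bsub>G\<^esub> then topspace T else N g)"
      using I Nop by (intro gdelta_in_Inter) (auto intro: open_imp_gdelta_in)
    ultimately show ?thesis by simp
  qed
  then show ?thesis
    unfolding free_shift_def
    by (intro standard_borel_restrict_gdelta[OF cm sc _ sets]) (simp add: top sp)
qed

lemma borel_graph_schreier_graph:
  fixes G :: "('g, 'm) monoid_scheme"
  assumes "group G" "countable (carrier G)" "S \<subseteq> carrier G" "finite S" "\<forall>s \<in> S. inv\<^bsub>G\<^esub> s \<in> S"
  shows "borel_graph (free_shift G) (schreier_graph G S)"
  unfolding borel_graph_def
proof (intro conjI)
  interpret group G by fact
  show "standard_borel (free_shift G)"
    using assms by (intro standard_borel_free_shift) auto
  have sp: "space (free_shift G) = free_part G"
    by (auto simp: free_shift_def free_part_def space_restrict_space)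
  have ext: "x \<in> extensional (carrier G)" if "x \<in> free_part G" for x
    using that by (auto simp: free_part_def shift_space_def space_PiM PiE_def)
  show "irrefl (schreier_graph G S)"
    by (auto simp: irrefl_def schreier_graph_def)
  show "sym (schreier_graph G S)"
  proof (rule symI)
    fix x y assume "(x, y) \<in> schreier_graph G S"
    then obtain s where s: "x \<in> free_part G" "y \<in> free_part G" "x \<noteq> y" "s \<in> S" "shift G s x = y"
      by (auto simp: schreier_graph_def)
    have "s \<in> carrier G" using s assms by auto
    then have "shift G (inv\<^bsub>G\<^esub> s) y = x"
      using ext[OF s(1)] unfolding s(5)[symmetric] shift_def
      by (auto simp: fun_eq_iff m_assoc extensional_def)
    then show "(y, x) \<in> schreier_graph G S"
      using s assms by (auto simp: schreier_graph_def)
  qed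
  define M where "M = free_shift G \<Otimes>\<^sub>M free_shift G"
  have coord: "(\<lambda>x. x h) \<in> free_shift G \<rightarrow>\<^sub>M count_space UNIV" if "h \<in> carrier G" for h
    unfolding free_shift_def shift_space_def using that
    by (intro measurable_restrict_space1 measurable_component_singleton) auto
  have eq: "{p \<in> space M. fst p h = snd p k} \<in> sets M" if "h \<in> carrier G" "k \<in> carrier G" for h k
  proof -
    have m: "(\<lambda>p. fst p h) \<in> M \<rightarrow>\<^sub>M count_space UNIV" "(\<lambda>p. snd p k) \<in> M \<rightarrow>\<^sub>M count_space UNIV"
      unfolding M_def
      using measurable_compose[OF measurable_fst coord] measurable_compose[OF measurable_snd coord] that
      by auto
    have "{p \<in> space M. fst p h = snd p k} =
        (\<Union>n. ((\<lambda>p. fst p h) -` {n} \<inter> space M) \<inter> ((\<lambda>p. snd p k) -` {n} \<inter> space M))"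
      by auto
    also have "\<dots> \<in> sets M"
      using m by (intro sets.countable_UN' sets.Int measurable_sets[of _ M "count_space UNIV"]) auto
    finally show ?thesis .
  qed
  have all: "{p \<in> space M. \<forall>h \<in> carrier G. fst p (a h) = snd p h} \<in> sets M"
    if "\<And>h. h \<in> carrier G \<Longrightarrow> a h \<in> carrier G" for a
  proof (cases "carrier G = {}")
    case False
    have "(\<Inter>h \<in> carrier G. {p \<in> space M. fst p (a h) = snd p h}) \<in> sets M"
      using assms(2) that False by (intro sets.countable_INT' image_subsetI eq) auto
    moreover have "(\<Inter>h \<in> carrier G. {p \<in> space M. fst p (a h) = snd p h}) =
        {p \<in> space M. \<forall>h \<in> carrier G. fst p (a h) = snd p h}"
      using False by auto
    ultimately show ?thesis by simp
  qed simp
  have "schreier_graph G S =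
      (\<Union>s \<in> S. {p \<in> space M. \<forall>h \<in> carrier G. fst p (h \<otimes>\<^bsub>G\<^esub> s) = snd p h} -
                {p \<in> space M. \<forall>h \<in> carrier G. fst p h = snd p h})"
  proof -
    have shift_eq: "shift G s x = y \<longleftrightarrow> (\<forall>h \<in> carrier G. x (h \<otimes>\<^bsub>G\<^esub> s) = y h)"
      if "y \<in> free_part G" for s x y
      using ext[OF that] by (auto simp: fun_eq_iff shift_def restrict_def extensional_def)
    have ext_eq: "x = y \<longleftrightarrow> (\<forall>h \<in> carrier G. x h = y h)"
      if "x \<in> free_part G" "y \<in> free_part G" for x y
      using ext that by (metis extensionalityI)
    have "p \<in> schreier_graph G S \<longleftrightarrow>
        p \<in> (\<Union>s \<in> S. {p \<in> space M. \<forall>h \<in> carrier G. fst p (h \<otimes>\<^bsub>G\<^esub> s) = snd p h} -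
                {p \<in> space M. \<forall>h \<in> carrier G. fst p h = snd p h})" for p
    proof (cases "p \<in> free_part G \<times> free_part G")
      case True
      then show ?thesis
        using shift_eq[of "snd p"] ext_eq[of "fst p" "snd p"]
        by (cases p) (simp add: schreier_graph_def M_def space_pair_measure sp conj_commute)
    next
      case False
      then show ?thesis
        by (auto simp: schreier_graph_def M_def space_pair_measure sp)
    qed
    then show ?thesis by blast
  qed
  also have "\<dots> \<in> sets M"
    using assms by (intro sets.finite_UN sets.Diff all) auto
  finally show "schreier_graph G S \<in> sets (free_shift G \<Otimes>\<^sub>M free_shift G)"
    by (simp add: M_def)
qed

end

theory Submission
  imports
    "HOL-Probability.Infinite_Product_Measure"
    "HOL-Probability.Probability_Mass_Function"
    "HOL-Analysis.Function_Metric"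
    Defs
begin

text \<open>
  Upper bound: mark each \<open>x\<close> by enough of its values to tell the neighbours \<open>s x\<close> apart, and
  colour \<open>x\<close> by \<open>x \<one>\<close> together with the marks of \<open>x\<close> and its neighbours. An automorphism
  preserving the colour respects the edge labels, so it is equivariant, so it fixes every point.

  Lower bound: if two points had the same colours along their orbits, matching the two orbits
  would be a colour-preserving automorphism. So for a distinguishing colouring \<open>c\<close> with \<open>k\<close>
  colours, \<open>x \<mapsto> (c (g x))\<^sub>g\<close> is injective. Put the uniform product measure on \<open>N\<close>
  symbols on the shift space. By inner regularity and compactness there are a set \<open>B\<close> of measure
  at least \<open>7/8\<close> and a finite \<open>F\<close> such that, for \<open>x\<close> in \<open>B\<close>, the colours of
  \<open>f x\<close>, \<open>f \<in> F\<close>, determine \<open>x \<one>\<close>. Take a Foelner set \<open>A\<close> with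
  \<open>|F A| \<le> 2 |A|\<close>. With probability at least \<open>3/4\<close>, \<open>a x \<in> B\<close> for at least half of
  the \<open>a \<in> A\<close>, and such \<open>x\<close> have at most \<open>2\<^bsup>|A|\<^esup> k\<^bsup>2|A|\<^esup> N\<^bsup>|A|/2\<^esup>\<close>
  restrictions to \<open>A\<close>. For \<open>N = (5 k\<^sup>2)\<^sup>2\<close> this is too few out of \<open>N\<^bsup>|A|\<^esup>\<close>. This
  replaces an entropy argument: since \<open>N\<close> may be chosen large, crude counting suffices.
\<close>

section \<open>Preliminaries\<close>

text \<open>Lists over a countable type form a countable type, so a list of measurable entries can
  be built one entry at a time by splitting over the countably many values of its head.\<close>

lemma measurable_map_count_space:
  fixes f :: "'b \<Rightarrow> 'a \<Rightarrow> 'c::countable"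
  assumes "\<And>a. a \<in> set xs \<Longrightarrow> f a \<in> M \<rightarrow>\<^sub>M count_space UNIV"
  shows "(\<lambda>x. map (\<lambda>a. f a x) xs) \<in> M \<rightarrow>\<^sub>M count_space UNIV"
  using assms
proof (induction xs)
  case (Cons a xs)
  have "(\<lambda>x. f a x # map (\<lambda>a. f a x) xs) \<in> M \<rightarrow>\<^sub>M count_space UNIV"
  proof (rule measurable_compose_countable[where f = "\<lambda>i x. i # map (\<lambda>a. f a x) xs"])
    show "f a \<in> M \<rightarrow>\<^sub>M count_space UNIV" using Cons by simp
    show "(\<lambda>x. i # map (\<lambda>a. f a x) xs) \<in> M \<rightarrow>\<^sub>M count_space UNIV" for i
      by (rule measurable_compose[OF Cons.IH]) (use Cons.prems in auto)
  qed
  then show ?case by simp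
qed simp

lemma standard_borel_count_space: "standard_borel (count_space (UNIV :: nat set))"
  unfolding standard_borel_def
proof (intro exI[of _ "discrete_topology UNIV"] conjI)
  show "completely_metrizable_space (discrete_topology (UNIV :: nat set))"
    by (rule completely_metrizable_space_discrete_topology)
  show "second_countable (discrete_topology (UNIV :: nat set))"
    unfolding second_countable_def by (intro exI[of _ "range (\<lambda>n. {n})"]) auto
  have "sigma_sets UNIV (UNIV :: nat set set) = UNIV" by (auto intro: sigma_sets.Basic)
  then show "sets (count_space (UNIV :: nat set)) =
      sigma_sets (topspace (discrete_topology UNIV)) {U. openin (discrete_topology UNIV) U}"
    by simp
qed simp

text \<open>Points of a metrizable space are closed. This makes colour classes measurable whatever
  standard Borel structure the colour space carries.\<close>

lemma standard_borel_singleton: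
  assumes "standard_borel M" "y \<in> space M"
  shows "{y} \<in> sets M"
proof -
  obtain T where T: "completely_metrizable_space T" "topspace T = space M"
      "sets M = sigma_sets (topspace T) {U. openin T U}"
    using assms unfolding standard_borel_def by blast
  have "closedin T {y}"
    using T assms(2) completely_metrizable_imp_metrizable_space metrizable_imp_t1_space
      t1_space_closedin_singleton by metis
  then have "topspace T - {y} \<in> sets M" unfolding T(3) by (auto simp: closedin_def)
  then have "space M - (space M - {y}) \<in> sets M" using T(2) by (metis sets.compl_sets)
  moreover have "space M - (space M - {y}) = {y}" using assms(2) by auto
  ultimately show ?thesis by simp
qed

lemma card_image_le_of_factor:
  assumes "finite (p ` S)" and "\<And>x y. x \<in> S \<Longrightarrow> y \<in> S \<Longrightarrow> p x = p y \<Longrightarrow> q x = q y"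
  shows "card (q ` S) \<le> card (p ` S)"
proof (rule surj_card_le[OF assms(1)])
  show "q ` S \<subseteq> (\<lambda>r. q (SOME x. x \<in> S \<and> p x = r)) ` p ` S"
  proof
    fix v assume "v \<in> q ` S"
    then obtain x where x: "x \<in> S" "v = q x" by auto
    define z where "z = (SOME z. z \<in> S \<and> p z = p x)"
    have "z \<in> S \<and> p z = p x"
      unfolding z_def by (rule someI[of _ x]) (simp add: x)
    then have "v = q z" using assms(2)[of x z] x by simp
    then show "v \<in> (\<lambda>r. q (SOME x. x \<in> S \<and> p x = r)) ` p ` S"
      using x(1) by (auto simp: z_def)
  qed
qed

section \<open>Inner regularity and compactness: reducing infinitely many separating functions to
  finitely many\<close>

text \<open>Each level set of each \<open>f n\<close> is replaced by a compact subset of almost full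
  measure. On the remaining compact set \<open>L\<close>, having different \<open>f n\<close>-values
  is a relatively open condition on pairs. These conditions cover the compact set of pairs of
  \<open>L\<close> in \<open>D\<close>, and a finite subcover bounds \<open>n\<close>.\<close>

lemma finite_determination:
  fixes M :: "'p::polish_space measure" and f :: "nat \<Rightarrow> 'p \<Rightarrow> 'y"
  assumes "finite_measure M" and sb: "sets M = sets borel"
    and Y: "finite Y" and W: "W \<in> sets M"
    and f: "\<And>n x. x \<in> W \<Longrightarrow> f n x \<in> Y"
    and fm: "\<And>n y. y \<in> Y \<Longrightarrow> {x \<in> W. f n x = y} \<in> sets M"
    and D: "closed D"
    and sep: "\<And>x y. x \<in> W \<Longrightarrow> y \<in> W \<Longrightarrow> (x, y) \<in> D \<Longrightarrow> \<exists>n. f n x \<noteq> f n y"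
    and \<epsilon>: "\<epsilon> > 0"
  obtains K m where "compact K" "K \<subseteq> W" "measure M (W - K) \<le> \<epsilon>"
    "\<And>x y. x \<in> K \<Longrightarrow> y \<in> K \<Longrightarrow> (x, y) \<in> D \<Longrightarrow> \<exists>n<m. f n x \<noteq> f n y"
proof -
  interpret finite_measure M by fact
  have inner: "\<exists>K. compact K \<and> K \<subseteq> B \<and> measure M (B - K) \<le> \<delta>"
    if B: "B \<in> sets M" and \<delta>: "\<delta> > 0" for B \<delta>
  proof -
    have "\<exists>K \<in> {K. K \<subseteq> B \<and> compact K}. measure M B - \<delta> < measure M K"
    proof (rule ccontr)
      assume "\<not> ?thesis"
      then have le: "measure M K \<le> measure M B - \<delta>" if "K \<subseteq> B" "compact K" for K
        using that by force
      \<comment> \<open>The empty set is compact. Without this sign, \<open>ennreal\<close> would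
        truncate the bound to 0 below.\<close>
      have nn: "0 \<le> measure M B - \<delta>" using le[of "{}"] by simp
      have "emeasure M B = (SUP K \<in> {K. K \<subseteq> B \<and> compact K}. emeasure M K)"
        using B sb by (intro inner_regular) auto
      also have "\<dots> \<le> ennreal (measure M B - \<delta>)"
        using le by (intro SUP_least) (auto simp: emeasure_eq_measure intro!: ennreal_leI)
      finally show False using \<delta> nn by (simp add: emeasure_eq_measure)
    qed
    then obtain K where K: "K \<subseteq> B" "compact K" "measure M B - \<delta> < measure M K" by auto
    have "K \<in> sets M" using K sb by (simp add: borel_compact)
    then have "measure M (B - K) = measure M B - measure M K"
      using B K by (intro finite_measure_Diff)
    then show ?thesis using K by (intro exI[of _ K]) auto
  qed
  \<comment> \<open>The errors of the \<open>card Y\<close> level sets add up to at most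
    \<open>\<epsilon> * (1/2) ^ Suc n\<close> for each \<open>n\<close>, and these sum to
    \<open>\<epsilon>\<close>. The added 1 keeps the divisor positive when \<open>Y\<close> is
    empty.\<close>
  define \<delta> where "\<delta> n = \<epsilon> * (1/2) ^ Suc n / (card Y + 1)" for n
  have \<delta>: "\<delta> n > 0" for n using \<epsilon> by (auto simp: \<delta>_def)
  define C where "C n y = (SOME K. compact K \<and> K \<subseteq> {x \<in> W. f n x = y} \<and>
      measure M ({x \<in> W. f n x = y} - K) \<le> \<delta> n)" for n y
  have "compact (C n y) \<and> C n y \<subseteq> {x \<in> W. f n x = y} \<and>
      measure M ({x \<in> W. f n x = y} - C n y) \<le> \<delta> n" if "y \<in> Y" for n y
    unfolding C_def by (rule someI_ex) (rule inner[OF fm[OF that] \<delta>])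
  then have C: "\<And>n y. y \<in> Y \<Longrightarrow> compact (C n y)"
      "\<And>n y. y \<in> Y \<Longrightarrow> C n y \<subseteq> {x \<in> W. f n x = y}"
      "\<And>n y. y \<in> Y \<Longrightarrow> measure M ({x \<in> W. f n x = y} - C n y) \<le> \<delta> n"
    by blast+
  have CD: "x \<in> W" "f n x = y" if "y \<in> Y" "x \<in> C n y" for x n y
    using C(2)[OF that(1)] that(2) by auto
  have Cm: "C n y \<in> sets M" if "y \<in> Y" for n y
    using C(1)[OF that] sb by (simp add: borel_compact)
  define K where "K n = (\<Union>y \<in> Y. C n y)" for n
  have Kc: "compact (K n)" for n unfolding K_def using Y C by (intro compact_UN) auto
  have Km: "K n \<in> sets M" for n using Kc sb by (simp add: borel_compact)
  have Kn: "measure M (W - K n) \<le> \<epsilon> * (1/2) ^ Suc n" for n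
  proof -
    have "W - K n \<subseteq> (\<Union>y \<in> Y. {x \<in> W. f n x = y} - C n y)"
      using f by (auto simp: K_def)
    then have "measure M (W - K n) \<le> measure M (\<Union>y \<in> Y. {x \<in> W. f n x = y} - C n y)"
      using Y fm Cm by (intro finite_measure_mono) auto
    also have "\<dots> \<le> (\<Sum>y \<in> Y. measure M ({x \<in> W. f n x = y} - C n y))"
      using Y fm Cm by (intro finite_measure_subadditive_finite) auto
    also have "\<dots> \<le> (\<Sum>y \<in> Y. \<delta> n)" using C by (intro sum_mono) auto
    also have "\<dots> \<le> \<epsilon> * (1/2) ^ Suc n"
      using \<epsilon> by (simp add: \<delta>_def divide_simps)
    finally show ?thesis .
  qed
  define L where "L = (\<Inter>n. K n)"
  have Lc: "compact L"
  proof -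
    have "closed L" unfolding L_def using Kc by (intro closed_INT) (auto intro: compact_imp_closed)
    moreover have "L = K 0 \<inter> L" by (auto simp: L_def)
    ultimately show ?thesis using Kc[of 0] by (metis compact_Int_closed)
  qed
  have LX: "L \<subseteq> W"
  proof
    fix x assume "x \<in> L"
    then have "x \<in> K 0" by (simp add: L_def)
    then show "x \<in> W" using CD by (auto simp: K_def)
  qed
  have L\<epsilon>: "measure M (W - L) \<le> \<epsilon>"
  proof -
    have sums: "(\<lambda>n. \<epsilon> * (1/2) ^ Suc n) sums (\<epsilon> * 1)"
      by (intro sums_mult power_half_series)
    have summ: "summable (\<lambda>n. measure M (W - K n))"
      using Kn by (intro summable_comparison_test[OF _ sums_summable[OF sums]]) auto
    have "measure M (W - L) = measure M (\<Union>n. W - K n)" by (simp add: L_def)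
    also have "\<dots> \<le> suminf (\<lambda>n. measure M (W - K n))"
      using summ W Km by (intro finite_measure_subadditive_countably) auto
    also have "\<dots> \<le> suminf (\<lambda>n. \<epsilon> * (1/2) ^ Suc n)"
      using Kn summ sums by (intro suminf_le) (auto simp: sums_iff)
    finally show ?thesis using sums by (simp add: sums_iff)
  qed
  \<comment> \<open>The sets \<open>C n y\<close> are closed, so \<open>U n\<close> is open. A pair
    from \<open>L\<close> lies in \<open>U n\<close> exactly when its \<open>f n\<close>-values
    differ.\<close>
  define U where "U n = - (\<Union>y \<in> Y. C n y \<times> C n y)" for n
  have Uop: "open (U n)" for n
    unfolding U_def using Y C(1)
    by (intro open_Compl closed_UN ballI closed_Times) (auto intro: compact_imp_closed)
  have cover: "(L \<times> L) \<inter> D \<subseteq> \<Union>(range U)"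
  proof
    fix p assume p: "p \<in> (L \<times> L) \<inter> D"
    then have "fst p \<in> W" "snd p \<in> W" "(fst p, snd p) \<in> D" using LX by auto
    then obtain n where n: "f n (fst p) \<noteq> f n (snd p)" using sep by blast
    have "p \<notin> C n y \<times> C n y" if "y \<in> Y" for y
      using n CD[OF that] by (cases p) auto
    then have "p \<in> U n" by (auto simp: U_def)
    then show "p \<in> \<Union>(range U)" by blast
  qed
  have cpt: "compact ((L \<times> L) \<inter> D)" by (intro compact_Int_closed compact_Times Lc D)
  have op: "open B" if "B \<in> range U" for B using that Uop by auto
  obtain F where F: "F \<subseteq> range U" "finite F" "(L \<times> L) \<inter> D \<subseteq> \<Union>F"
    by (rule compactE[OF cpt cover op])
  from finite_subset_image[OF F(2,1)] obtain J where J: "finite J" "F = U ` J" by blast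
  show thesis
  \<comment> \<open>The bound on \<open>n\<close> is strict, hence the successor. If
    \<open>J\<close> is empty, no pair of points of \<open>L\<close> lies in \<open>D\<close>, so
    the unspecified \<open>Max {}\<close> is harmless.\<close>
  proof (rule that[of L "Suc (Max J)"])
    fix x w assume xy: "x \<in> L" "w \<in> L" "(x, w) \<in> D"
    then obtain n where n: "n \<in> J" "(x, w) \<in> U n" using F(3) J by blast
    have "f n x \<noteq> f n w"
    proof
      assume eq: "f n x = f n w"
      have "x \<in> K n" "w \<in> K n" using xy by (auto simp: L_def)
      then obtain y z where "y \<in> Y" "x \<in> C n y" "z \<in> Y" "w \<in> C n z"
        by (auto simp: K_def)
      then show False using n(2) CD eq by (auto simp: U_def)
    qed
    then show "\<exists>n<Suc (Max J). f n x \<noteq> f n w"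
      using n J by (intro exI[of _ n]) (simp add: less_Suc_eq_le)
  qed (fact Lc LX L\<epsilon>)+
qed

section \<open>The shift action and its automorphisms\<close>

locale countable_group = group G for G :: "('g, 'm) monoid_scheme" (structure) +
  assumes countable_carrier: "countable (carrier G)"
begin

lemma space_shift_space: "space (shift_space G) = carrier G \<rightarrow>\<^sub>E UNIV"
  by (simp add: shift_space_def space_PiM)

lemma shift_apply: "h \<in> carrier G \<Longrightarrow> shift G g x h = x (h \<otimes> g)"
  by (simp add: shift_def)

lemma shift_in_space [simp]: "shift G g x \<in> carrier G \<rightarrow>\<^sub>E UNIV"
  by (simp add: shift_def)

lemma shift_mult:
  "g \<in> carrier G \<Longrightarrow> h \<in> carrier G \<Longrightarrow> shift G g (shift G h x) = shift G (g \<otimes> h) x"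
  by (auto simp: shift_def fun_eq_iff m_assoc)

lemma shift_one: "x \<in> carrier G \<rightarrow>\<^sub>E UNIV \<Longrightarrow> shift G \<one> x = x"
  by (auto simp: shift_def fun_eq_iff PiE_def extensional_def)

lemma free_partD: "x \<in> free_part G \<Longrightarrow> x \<in> carrier G \<rightarrow>\<^sub>E UNIV"
  by (simp add: free_part_def space_shift_space)

text \<open>If \<open>g\<close> and \<open>h\<close> move \<open>x\<close> to the same point, then
  \<open>inv h \<otimes> g\<close> fixes \<open>x\<close>, and freeness makes it the identity. So a
  base point parametrizes its orbit by the group without repetition, which justifies the
  \<open>THE\<close> in \<open>orbit_swap\<close>.\<close>

lemma shift_eq_iff:
  assumes "x \<in> free_part G" "g \<in> carrier G" "h \<in> carrier G"
  shows "shift G g x = shift G h x \<longleftrightarrow> g = h"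
proof
  assume eq: "shift G g x = shift G h x"
  have "shift G (inv h \<otimes> g) x = shift G (inv h) (shift G g x)"
    using assms by (simp add: shift_mult)
  also have "\<dots> = x"
    using assms by (simp add: eq shift_mult shift_one free_partD)
  finally have "inv h \<otimes> g = \<one>"
    using assms unfolding free_part_def by blast
  then show "g = h" using assms by (metis inv_solve_left' r_one one_closed)
qed simp

lemma shift_free_part:
  assumes x: "x \<in> free_part G" and g: "g \<in> carrier G"
  shows "shift G g x \<in> free_part G"
  unfolding free_part_def
proof (intro CollectI conjI ballI)
  show "shift G g x \<in> space (shift_space G)" by (simp add: space_shift_space)
  fix h assume h: "h \<in> carrier G - {\<one>}"
  then have "h \<otimes> g \<noteq> g" using g by simp
  then show "shift G h (shift G g x) \<noteq> shift G g x"
    using shift_eq_iff[OF x, of "h \<otimes> g" g] h g by (simp add: shift_mult)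
qed

lemma shift_free_part_iff:
  assumes "x \<in> carrier G \<rightarrow>\<^sub>E UNIV" "g \<in> carrier G"
  shows "shift G g x \<in> free_part G \<longleftrightarrow> x \<in> free_part G"
  using shift_free_part[of "shift G g x" "inv g"] shift_free_part[of x g] assms
  by (auto simp: shift_mult shift_one)

lemma space_free_shift: "space (free_shift G) = free_part G"
  by (auto simp: free_shift_def free_part_def space_restrict_space)

lemma coordinate_measurable:
  "h \<in> carrier G \<Longrightarrow> (\<lambda>x. x h) \<in> shift_space G \<rightarrow>\<^sub>M count_space UNIV"
  unfolding shift_space_def by measurable

lemma shift_measurable:
  assumes "g \<in> carrier G"
  shows "shift G g \<in> shift_space G \<rightarrow>\<^sub>M shift_space G"
  using assms coordinate_measurable unfolding shift_def[abs_def]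
  by (subst (2) shift_space_def) (intro measurable_restrict, simp)

lemma free_part_sets: "free_part G \<in> sets (shift_space G)"
proof -
  have "{x \<in> space (shift_space G). shift G g x \<noteq> x} \<in> sets (shift_space G)"
    if g: "g \<in> carrier G" for g
  proof -
    have "{x \<in> space (shift_space G). shift G g x \<noteq> x} =
        {x \<in> space (shift_space G). \<exists>h \<in> carrier G. x (h \<otimes> g) \<noteq> x h}"
      by (rule Collect_cong, rule conj_cong[OF refl])
        (auto simp: space_shift_space shift_def fun_eq_iff PiE_def extensional_def)
    also have "\<dots> \<in> sets (shift_space G)"
      using countable_carrier coordinate_measurable g
      by (intro sets.sets_Collect_countable_Ex' ) (auto intro!: measurable_equality_set)
    finally show ?thesis .
  qed
  then have "{x \<in> space (shift_space G). \<forall>g \<in> carrier G - {\<one>}. shift G g x \<noteq> x} \<in> sets (shift_space G)"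
    using countable_carrier by (intro sets.sets_Collect_countable_All') auto
  then show ?thesis by (simp add: free_part_def)
qed

lemma shift_measurable_free:
  assumes "g \<in> carrier G"
  shows "shift G g \<in> free_shift G \<rightarrow>\<^sub>M free_shift G"
  unfolding free_shift_def
proof (rule measurable_restrict_space3)
  show "shift G g \<in> shift_space G \<rightarrow>\<^sub>M shift_space G" using assms by (rule shift_measurable)
  show "shift G g \<in> free_part G \<rightarrow> free_part G" using assms shift_free_part by blast
qed

lemma schreier_graph_iff:
  assumes "S \<subseteq> carrier G" "\<one> \<notin> S" "x \<in> free_part G"
  shows "(x, y) \<in> schreier_graph G S \<longleftrightarrow> (\<exists>s \<in> S. y = shift G s x)"
proof -
  have "x \<noteq> shift G s x" if "s \<in> S" for s
  proof -
    have "s \<in> carrier G - {\<one>}" using assms that by blast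
    then show ?thesis using assms(3) unfolding free_part_def by force
  qed
  then show ?thesis
    using assms shift_free_part[OF assms(3)] by (auto simp: schreier_graph_def)
qed

text \<open>Edges are defined through the action alone, so commuting with the action preserves them;
  injectivity of \<psi> gives the converse.\<close>

lemma equivariant_automorphism:
  assumes S: "S \<subseteq> carrier G" "\<one> \<notin> S"
    and bij: "bij_betw \<psi> (free_part G) (free_part G)"
    and eq: "\<And>g x. g \<in> carrier G \<Longrightarrow> x \<in> free_part G \<Longrightarrow> \<psi> (shift G g x) = shift G g (\<psi> x)"
  shows "graph_automorphism (free_part G) (schreier_graph G S) \<psi>"
  unfolding graph_automorphism_def
proof (intro conjI ballI bij)
  fix x y assume xy: "x \<in> free_part G" "y \<in> free_part G"
  then have \<psi>x: "\<psi> x \<in> free_part G" using bij by (auto simp: bij_betw_def)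
  have "\<psi> y = shift G s (\<psi> x) \<longleftrightarrow> y = shift G s x" if "s \<in> S" for s
    using that xy S bij shift_free_part[OF xy(1), of s] eq[of s x]
    by (metis bij_betw_def inj_on_eq_iff subsetD)
  then show "(\<psi> x, \<psi> y) \<in> schreier_graph G S \<longleftrightarrow> (x, y) \<in> schreier_graph G S"
    using S xy \<psi>x by (simp add: schreier_graph_iff)
qed

section \<open>Exchanging two orbits\<close>

definition orb :: "('g \<Rightarrow> nat) \<Rightarrow> ('g \<Rightarrow> nat) set" where
  "orb x = (\<lambda>g. shift G g x) ` carrier G"

text \<open>For \<open>x\<close>, \<open>y\<close> in different orbits this exchanges \<open>g x\<close> and \<open>g y\<close>; in a common orbit it is
  the translation \<open>g x \<mapsto> g y\<close>. In both cases \<open>orbit_swap y x\<close> is the inverse.\<close>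

definition orbit_swap :: "('g \<Rightarrow> nat) \<Rightarrow> ('g \<Rightarrow> nat) \<Rightarrow> ('g \<Rightarrow> nat) \<Rightarrow> ('g \<Rightarrow> nat)" where
  "orbit_swap x y z =
     (if z \<in> orb x then shift G (THE g. g \<in> carrier G \<and> z = shift G g x) y
      else if z \<in> orb y then shift G (THE g. g \<in> carrier G \<and> z = shift G g y) x
      else z)"

lemma orb_shift_iff:
  assumes "z \<in> free_part G" "g \<in> carrier G"
  shows "shift G g z \<in> orb x \<longleftrightarrow> z \<in> orb x"
proof
  assume "shift G g z \<in> orb x"
  then obtain h where h: "h \<in> carrier G" "shift G g z = shift G h x" by (auto simp: orb_def)
  then have "z = shift G (inv g \<otimes> h) x"
    using assms by (metis shift_mult inv_closed l_inv shift_one free_partD)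
  then show "z \<in> orb x" using h assms by (auto simp: orb_def)
next
  assume "z \<in> orb x"
  then show "shift G g z \<in> orb x" using assms by (auto simp: orb_def shift_mult)
qed

lemma the_shift:
  assumes "x \<in> free_part G" "g \<in> carrier G"
  shows "(THE h. h \<in> carrier G \<and> shift G g x = shift G h x) = g"
  using assms by (intro the_equality) (auto simp: shift_eq_iff)

lemma orbit_swap_left:
  "x \<in> free_part G \<Longrightarrow> g \<in> carrier G \<Longrightarrow> orbit_swap x y (shift G g x) = shift G g y"
  by (auto simp: orbit_swap_def the_shift orb_def)

text \<open>When the two orbits coincide, the first branch of \<open>orbit_swap\<close> takes
  precedence; this formula is for points that only the second branch reaches.\<close>

lemma orbit_swap_right:
  "y \<in> free_part G \<Longrightarrow> g \<in> carrier G \<Longrightarrow> shift G g y \<notin> orb x \<Longrightarrow>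
    orbit_swap x y (shift G g y) = shift G g x"
  by (auto simp: orbit_swap_def the_shift orb_def)

lemma orbit_swap_cases:
  obtains (left) g where "g \<in> carrier G" "z = shift G g x"
    | (right) g where "g \<in> carrier G" "z = shift G g y" "z \<notin> orb x"
    | (out) "z \<notin> orb x" "z \<notin> orb y"
  by (cases "z \<in> orb x"; cases "z \<in> orb y") (auto simp: orb_def)

lemma orb_eq:
  assumes "z \<in> orb x" "x \<in> free_part G"
  shows "orb z = orb x"
proof -
  obtain g where g: "g \<in> carrier G" "z = shift G g x" using assms by (auto simp: orb_def)
  have z: "z \<in> free_part G" using g assms shift_free_part by auto
  have "x = shift G (inv g) z"
    using g assms by (simp add: shift_mult shift_one free_partD)
  then have "x \<in> orb z" using g by (auto simp: orb_def)
  have sub: "orb v \<subseteq> orb w" if "v \<in> free_part G" "v \<in> orb w" for v w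
    unfolding orb_def[of v] using orb_shift_iff[OF that(1)] that(2) by auto
  show ?thesis
    using sub[OF z assms(1)] sub[OF assms(2) \<open>x \<in> orb z\<close>] by blast
qed

lemma orbit_swap_inverse:
  assumes x: "x \<in> free_part G" and y: "y \<in> free_part G" and z: "z \<in> free_part G"
  shows "orbit_swap y x (orbit_swap x y z) = z"
proof (cases rule: orbit_swap_cases[where z = z and x = x and y = y])
  case (left g)
  then show ?thesis using x y by (simp add: orbit_swap_left)
next
  case (right g)
  \<comment> \<open>Otherwise the two orbits would coincide and \<open>z\<close> would lie in
    \<open>orb x\<close>, against the case. Hence the inverse map also takes its second
    branch.\<close>
  have "shift G g x \<notin> orb y"
  proof
    assume "shift G g x \<in> orb y"
    then have "x \<in> orb y" using x right by (simp add: orb_shift_iff)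
    then have "orb x = orb y" using y by (rule orb_eq)
    then show False using right by (auto simp: orb_def)
  qed
  then show ?thesis using right x y by (simp add: orbit_swap_right)
next
  case out
  then show ?thesis by (simp add: orbit_swap_def)
qed

lemma orbit_swap_free_part:
  assumes x: "x \<in> free_part G" and y: "y \<in> free_part G" and z: "z \<in> free_part G"
  shows "orbit_swap x y z \<in> free_part G"
  using assms
  by (cases rule: orbit_swap_cases[where z = z and x = x and y = y])
    (auto simp: orbit_swap_left orbit_swap_right shift_free_part, simp add: orbit_swap_def)

lemma orbit_swap_bij:
  assumes "x \<in> free_part G" "y \<in> free_part G"
  shows "bij_betw (orbit_swap x y) (free_part G) (free_part G)"
  using assms by (intro bij_betw_byWitness[where f' = "orbit_swap y x"])
    (auto simp: orbit_swap_inverse orbit_swap_free_part)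

lemma orbit_swap_equivariant:
  assumes x: "x \<in> free_part G" and y: "y \<in> free_part G" and z: "z \<in> free_part G"
    and h: "h \<in> carrier G"
  shows "orbit_swap x y (shift G h z) = shift G h (orbit_swap x y z)"
proof (cases rule: orbit_swap_cases[where z = z and x = x and y = y])
  case (left g)
  then show ?thesis using x y h by (simp add: orbit_swap_left shift_mult)
next
  case (right g)
  then have "shift G (h \<otimes> g) y \<notin> orb x"
    using orb_shift_iff[OF z h, of x] h by (simp add: shift_mult)
  then show ?thesis using right x y h by (simp add: orbit_swap_right shift_mult)
next
  case out
  then show ?thesis using orb_shift_iff[OF z h] by (simp add: orbit_swap_def)
qed

text \<open>Equal colours along the two orbits make \<open>orbit_swap x y\<close> a
  colour-preserving automorphism, and it sends \<open>x\<close> to \<open>y\<close>. This includes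
  the case of a common orbit, where the map is a translation.\<close>

lemma distinguishing_separates:
  assumes S: "S \<subseteq> carrier G" "\<one> \<notin> S"
    and c: "borel_distinguishing_coloring (free_shift G) (schreier_graph G S) Y c"
    and x: "x \<in> free_part G" and y: "y \<in> free_part G"
    and eq: "\<And>g. g \<in> carrier G \<Longrightarrow> c (shift G g x) = c (shift G g y)"
  shows "x = y"
proof (rule ccontr)
  assume "x \<noteq> y"
  moreover have "orbit_swap x y x = y"
    using orbit_swap_left[OF x one_closed, of y] x y by (simp add: shift_one free_partD)
  ultimately have "\<exists>x \<in> free_part G. orbit_swap x y x \<noteq> x" using x by metis
  moreover have "graph_automorphism (free_part G) (schreier_graph G S) (orbit_swap x y)"
    using S x y by (intro equivariant_automorphism orbit_swap_bij orbit_swap_equivariant)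
  ultimately obtain z where z: "z \<in> free_part G" "c (orbit_swap x y z) \<noteq> c z"
    using c x \<open>x \<noteq> y\<close> \<open>orbit_swap x y x = y\<close>
    unfolding borel_distinguishing_coloring_def space_free_shift by metis
  have "c (orbit_swap x y z) = c z"
  proof (cases rule: orbit_swap_cases[where z = z and x = x and y = y])
    case (left g)
    then show ?thesis using x y eq by (simp add: orbit_swap_left)
  next
    case (right g)
    then show ?thesis using x y eq by (simp add: orbit_swap_right)
  next
    case out
    then show ?thesis by (simp add: orbit_swap_def)
  qed
  then show False using z by simp
qed


section \<open>A distinguishing colouring with countably many colours\<close>

text \<open>\<open>x\<close> and \<open>g x\<close> are told apart by the first place where they differ, together with
  the value there.\<close>

definition diff_index :: "'g \<Rightarrow> ('g \<Rightarrow> nat) \<Rightarrow> nat" where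
  "diff_index g x = (LEAST n. x (from_nat_into (carrier G) n \<otimes> g) \<noteq> x (from_nat_into (carrier G) n))"

definition diff_mark :: "'g \<Rightarrow> ('g \<Rightarrow> nat) \<Rightarrow> nat \<times> nat" where
  "diff_mark g x = (diff_index g x, x (from_nat_into (carrier G) (diff_index g x)))"

lemma from_nat_into_carrier [simp]: "from_nat_into (carrier G) n \<in> carrier G"
  using from_nat_into[of "carrier G"] one_closed by blast

text \<open>If the marks agreed, both points would have the same index, and their values at that
  place would be equal. But the index was chosen as a place where \<open>x\<close> and its shift
  differ.\<close>

lemma diff_mark_shift_neq:
  assumes x: "x \<in> free_part G" and g: "g \<in> carrier G" "g \<noteq> \<one>"
  shows "diff_mark g (shift G g x) \<noteq> diff_mark g x"
proof
  assume eq: "diff_mark g (shift G g x) = diff_mark g x"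
  let ?h = "from_nat_into (carrier G) (diff_index g x)"
  have "shift G g x \<noteq> x" using x g by (auto simp: free_part_def)
  then obtain h where h: "h \<in> carrier G" "x (h \<otimes> g) \<noteq> x h"
    using PiE_ext[OF shift_in_space free_partD[OF x], of g] shift_apply by metis
  then obtain n where "h = from_nat_into (carrier G) n"
    using from_nat_into_surj countable_carrier by metis
  then have "x (?h \<otimes> g) \<noteq> x ?h"
    unfolding diff_index_def using h by (intro LeastI) auto
  moreover have "shift G g x ?h = x ?h"
    using eq by (auto simp: diff_mark_def)
  ultimately show False by (simp add: shift_apply)
qed

lemma diff_mark_measurable:
  assumes g: "g \<in> carrier G"
  shows "diff_mark g \<in> free_shift G \<rightarrow>\<^sub>M count_space UNIV"
  unfolding free_shift_def
proof (rule measurable_restrict_space1)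
  have co: "(\<lambda>x. x (from_nat_into (carrier G) n)) \<in> shift_space G \<rightarrow>\<^sub>M count_space UNIV"
    "(\<lambda>x. x (from_nat_into (carrier G) n \<otimes> g)) \<in> shift_space G \<rightarrow>\<^sub>M count_space UNIV" for n
    using g by (auto intro: coordinate_measurable)
  have ix: "diff_index g \<in> shift_space G \<rightarrow>\<^sub>M count_space UNIV"
    unfolding diff_index_def
  proof (rule measurable_Least)
    fix n
    \<comment> \<open>The redex is kept so that \<open>measurable_compose_countable\<close> finds a
      family indexed by the countably many values of one coordinate.\<close>
    have "(\<lambda>x. (\<lambda>i x. i \<noteq> x (from_nat_into (carrier G) n))
        (x (from_nat_into (carrier G) n \<otimes> g)) x) \<in> shift_space G \<rightarrow>\<^sub>M count_space UNIV"
      by (rule measurable_compose_countable[OF measurable_compose[OF co(1)] co(2)]) simp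
    then show "Measurable.pred (shift_space G)
        (\<lambda>x. x (from_nat_into (carrier G) n \<otimes> g) \<noteq> x (from_nat_into (carrier G) n))"
      by simp
  qed
  have "(\<lambda>x. (\<lambda>n x. (n, x (from_nat_into (carrier G) n))) (diff_index g x) x)
      \<in> shift_space G \<rightarrow>\<^sub>M count_space UNIV"
  proof (rule measurable_compose_countable[OF _ ix])
    show "(\<lambda>x. (n, x (from_nat_into (carrier G) n))) \<in> shift_space G \<rightarrow>\<^sub>M count_space UNIV" for n
      using co(1) by (rule measurable_compose) simp
  qed
  then show "diff_mark g \<in> shift_space G \<rightarrow>\<^sub>M count_space UNIV"
    by (simp add: diff_mark_def[abs_def])
qed

text \<open>Inverses of generators are generators, so in the induction only products need an
  argument: commute with \<open>h1\<close> at the free point \<open>h2 x\<close>, then with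
  \<open>h2\<close> at \<open>x\<close>.\<close>

lemma equivariant_of_generators:
  assumes gen: "generate G S = carrier G" and S: "S \<subseteq> carrier G" "\<forall>s \<in> S. inv s \<in> S"
    and \<psi>: "\<And>x. x \<in> free_part G \<Longrightarrow> \<psi> x \<in> free_part G"
    and eq: "\<And>s x. s \<in> S \<Longrightarrow> x \<in> free_part G \<Longrightarrow> \<psi> (shift G s x) = shift G s (\<psi> x)"
    and x: "x \<in> free_part G" and g: "g \<in> carrier G"
  shows "\<psi> (shift G g x) = shift G g (\<psi> x)"
proof -
  have "g \<in> generate G S" using g gen by simp
  then show ?thesis using x
  proof (induction g arbitrary: x)
    case one
    then show ?case using \<psi> by (simp add: shift_one free_partD)
  next
    case (eng h1 h2)
    then have "h1 \<in> carrier G" "h2 \<in> carrier G" using gen by auto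
    then show ?case using eng \<psi> by (simp add: shift_mult[symmetric] shift_free_part)
  qed (use eq S in auto)
qed

text \<open>A colour-preserving automorphism permutes the neighbours of each vertex compatibly with
  the edge labels \<open>s\<close>, because the colour of \<open>x\<close> records marks distinguishing the
  neighbours \<open>s x\<close>. So it is equivariant, and then \<open>x h = (h x) \<one>\<close> is preserved as well.\<close>

lemma countable_distinguishing_coloring:
  assumes S: "S \<subseteq> carrier G" "finite S" "generate G S = carrier G"
    "\<forall>s \<in> S. inv s \<in> S" "\<one> \<notin> S"
  shows "\<exists>c. borel_distinguishing_coloring (free_shift G) (schreier_graph G S)
    (count_space (UNIV :: nat set)) c"
proof -
  \<comment> \<open>If \<psi> sends \<open>s x\<close> to \<open>t (\<psi> x)\<close>, then
    \<open>t \<otimes> inv s\<close> carries the expected image \<open>s (\<psi> x)\<close> to the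
    actual one. Marks for these finitely many elements suffice to compare the two.\<close>
  define D where "D = {t \<otimes> inv s | s t. s \<in> S \<and> t \<in> S}"
  have D: "finite D" "D \<subseteq> carrier G"
  proof -
    have "D = (\<lambda>(s, t). t \<otimes> inv s) ` (S \<times> S)" by (auto simp: D_def)
    then show "finite D" "D \<subseteq> carrier G" using S by auto
  qed
  obtain L where L: "set L = insert \<one> S \<times> D"
    using finite_list[of "insert \<one> S \<times> D"] D S by auto
  \<comment> \<open>Marks are taken at \<open>x\<close> and at its neighbours. Being a list, they
    lie in a countable type, so \<open>to_nat\<close> can turn the whole colour into one
    number.\<close>
  define marks where "marks x = map (\<lambda>p. diff_mark (snd p) (shift G (fst p) x)) L" for x
  define c where "c x = to_nat (x \<one>, marks x)" for x
  have marksD: "diff_mark g (shift G s x) = diff_mark g (shift G s y)"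
    if "c x = c y" "s \<in> insert \<one> S" "g \<in> D" for x y s g
  proof -
    have "marks x = marks y" using that(1) by (simp add: c_def)
    moreover have "(s, g) \<in> set L" using that L by auto
    ultimately show ?thesis unfolding marks_def map_eq_conv by force
  qed
  have cm: "c \<in> free_shift G \<rightarrow>\<^sub>M count_space UNIV"
  proof -
    have one: "(\<lambda>x. x \<one>) \<in> free_shift G \<rightarrow>\<^sub>M count_space UNIV"
      unfolding free_shift_def by (intro measurable_restrict_space1 coordinate_measurable) simp
    have "marks \<in> free_shift G \<rightarrow>\<^sub>M count_space UNIV"
      unfolding marks_def[abs_def]
    proof (rule measurable_map_count_space)
      fix p assume "p \<in> set L"
      then have "fst p \<in> carrier G" "snd p \<in> carrier G" using L S D by auto
      then show "(\<lambda>x. diff_mark (snd p) (shift G (fst p) x)) \<in> free_shift G \<rightarrow>\<^sub>M count_space UNIV"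
        by (intro measurable_compose[OF shift_measurable_free diff_mark_measurable])
    qed
    then have "(\<lambda>x. to_nat (i, marks x)) \<in> free_shift G \<rightarrow>\<^sub>M count_space UNIV" for i :: nat
      by (rule measurable_compose) simp
    from measurable_compose_countable[OF this one] show ?thesis by (simp add: c_def[abs_def])
  qed
  have "\<exists>x \<in> free_part G. c (\<psi> x) \<noteq> c x"
    if aut: "graph_automorphism (free_part G) (schreier_graph G S) \<psi>"
      and nontriv: "\<exists>x \<in> free_part G. \<psi> x \<noteq> x" for \<psi>
  proof (rule ccontr)
    assume "\<not> ?thesis"
    then have pres: "c (\<psi> x) = c x" if "x \<in> free_part G" for x using that by blast
    have \<psi>: "\<psi> x \<in> free_part G" if "x \<in> free_part G" for x
      using aut that by (auto simp: graph_automorphism_def bij_betw_def)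
    have gens: "\<psi> (shift G s x) = shift G s (\<psi> x)" if s: "s \<in> S" and x: "x \<in> free_part G" for s x
    proof -
      have sx: "shift G s x \<in> free_part G" using s x S shift_free_part by auto
      have "(x, shift G s x) \<in> schreier_graph G S"
        using s x S schreier_graph_iff by auto
      then have "(\<psi> x, \<psi> (shift G s x)) \<in> schreier_graph G S"
        using aut x sx by (simp add: graph_automorphism_def)
      then obtain t where t: "t \<in> S" "\<psi> (shift G s x) = shift G t (\<psi> x)"
        using schreier_graph_iff S \<psi>[OF x] by auto
      have st: "s \<in> carrier G" "t \<in> carrier G" using s t S by auto
      let ?w = "shift G s (\<psi> x)" and ?g = "t \<otimes> inv s"
      have g: "?g \<in> D" using s t by (auto simp: D_def)
      have w: "?w \<in> free_part G" using \<psi>[OF x] st shift_free_part by auto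
      have gw: "shift G ?g ?w = \<psi> (shift G s x)"
        using st t by (simp add: shift_mult m_assoc)
      \<comment> \<open>The colour of \<open>s x\<close>, read at position \<open>\<one>\<close>,
        and the colour of \<open>x\<close>, read at position \<open>s\<close>, show that
        \<open>?w\<close> and \<open>?g ?w\<close> have the same \<open>?g\<close>-mark. This is
        possible only if \<open>?g\<close> is the identity.\<close>
      have "diff_mark ?g (shift G \<one> (\<psi> (shift G s x))) = diff_mark ?g (shift G \<one> (shift G s x))"
        using pres[OF sx] g by (intro marksD) auto
      also have "\<dots> = diff_mark ?g (shift G s x)"
        using sx by (simp add: shift_one free_partD)
      also have "\<dots> = diff_mark ?g ?w"
        using pres[OF x] g s by (intro marksD) auto
      finally have "diff_mark ?g (shift G ?g ?w) = diff_mark ?g ?w"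
        using \<psi>[OF sx] by (simp add: gw shift_one free_partD)
      then have "?g = \<one>"
        using diff_mark_shift_neq[OF w, of ?g] st by auto
      then have "t = s" using st by (metis inv_equality inv_inv inv_closed)
      then show ?thesis using t by simp
    qed
    have "\<psi> x = x" if x: "x \<in> free_part G" for x
    proof (rule PiE_ext[OF free_partD[OF \<psi>[OF x]] free_partD[OF x]])
      fix h assume h: "h \<in> carrier G"
      have eq: "\<psi> (shift G h x) = shift G h (\<psi> x)"
        by (rule equivariant_of_generators[OF S(3,1,4) \<psi> gens x h])
      have "c (\<psi> (shift G h x)) = c (shift G h x)" using pres x h shift_free_part by auto
      then have "shift G h (\<psi> x) \<one> = shift G h x \<one>" by (simp add: eq c_def)
      then show "\<psi> x h = x h" using h by (simp add: shift_apply)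
    qed
    then show False using nontriv by blast
  qed
  then show ?thesis
    unfolding borel_distinguishing_coloring_def space_free_shift
    using cm standard_borel_count_space by blast
qed


section \<open>The uniform product measure\<close>

text \<open>The factors are measures on all of \<open>nat\<close> concentrated on
  \<open>{..<N}\<close>, so the sigma-algebra is that of \<open>shift_space G\<close> for every
  \<open>N\<close>, and finite alphabets live inside the one shift space.\<close>

definition unif :: "nat \<Rightarrow> ('g \<Rightarrow> nat) measure" where
  "unif N = (\<Pi>\<^sub>M h \<in> carrier G. measure_pmf (pmf_of_set {..<N}))"

lemma sets_unif [measurable_cong]: "sets (unif N) = sets (shift_space G)"
  unfolding unif_def shift_space_def by (intro sets_PiM_cong) auto

lemma space_unif: "space (unif N) = carrier G \<rightarrow>\<^sub>E UNIV"
  by (simp add: unif_def space_PiM)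

lemma prob_space_unif: "prob_space (unif N)"
  unfolding unif_def by (intro prob_space_PiM measure_pmf.prob_space_axioms)

lemma shift_measurable_unif: "g \<in> carrier G \<Longrightarrow> shift G g \<in> unif N \<rightarrow>\<^sub>M unif N"
  by (subst measurable_cong_sets[OF sets_unif sets_unif]) (rule shift_measurable)

text \<open>The shift reindexes the coordinates by a right translation, which is injective, and all
  factors of the product are equal.\<close>

lemma unif_shift_invariant:
  assumes g: "g \<in> carrier G"
  shows "distr (unif N) (unif N) (shift G g) = unif N"
proof -
  have "inj_on (\<lambda>h. h \<otimes> g) (carrier G)" "(\<lambda>h. h \<otimes> g) \<in> carrier G \<rightarrow> carrier G"
    using g by (auto simp: inj_on_def)
  from distr_PiM_reindex[of "carrier G" "\<lambda>_. measure_pmf (pmf_of_set {..<N})", OF _ this]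
  show ?thesis
    by (simp add: unif_def shift_def[abs_def] measure_pmf.prob_space_axioms)
qed

lemma measure_unif_shift:
  assumes "g \<in> carrier G" "B \<in> sets (unif N)"
  shows "measure (unif N) {x \<in> space (unif N). shift G g x \<in> B} = measure (unif N) B"
proof -
  have "measure (unif N) B = measure (distr (unif N) (unif N) (shift G g)) B"
    using assms by (simp add: unif_shift_invariant)
  also have "\<dots> = measure (unif N) (shift G g -` B \<inter> space (unif N))"
    using assms by (intro measure_distr shift_measurable_unif)
  also have "shift G g -` B \<inter> space (unif N) = {x \<in> space (unif N). shift G g x \<in> B}" by auto
  finally show ?thesis by simp
qed

text \<open>Each coordinate contributes a factor \<open>1/N\<close>, or 0 if the prescribed value is
  outside \<open>{..<N}\<close>; hence an inequality.\<close>

lemma measure_unif_cylinder_le: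
  assumes A: "A \<subseteq> carrier G" "finite A" and N: "N > 0"
  shows "measure (unif N) {x \<in> space (unif N). \<forall>a \<in> A. x a = v a} \<le> 1 / real N ^ card A"
proof -
  interpret product_prob_space "\<lambda>_. measure_pmf (pmf_of_set {..<N})" "carrier G" by unfold_locales
  have "emeasure (unif N) {x \<in> space (unif N). \<forall>a \<in> A. x a \<in> {v a}} =
      (\<Prod>a \<in> A. emeasure (measure_pmf (pmf_of_set {..<N})) {v a})"
    unfolding unif_def using A by (intro emeasure_PiM_Collect) auto
  also have "\<dots> = ennreal (\<Prod>a \<in> A. pmf (pmf_of_set {..<N}) (v a))"
    by (simp add: emeasure_pmf_single prod_ennreal)
  finally have "measure (unif N) {x \<in> space (unif N). \<forall>a \<in> A. x a \<in> {v a}} =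
      (\<Prod>a \<in> A. pmf (pmf_of_set {..<N}) (v a))"
    by (simp add: measure_def prod_nonneg)
  also have "\<dots> \<le> (\<Prod>a \<in> A. 1 / real N)"
    using N by (intro prod_mono) (auto simp: indicator_def pmf_of_set lessThan_empty_iff)
  finally show ?thesis by (simp add: power_divide)
qed

lemma AE_unif_less:
  assumes N: "N > 0"
  shows "AE x in unif N. \<forall>h \<in> carrier G. x h < N"
proof (rule AE_ball_countable'[OF _ countable_carrier])
  fix h assume h: "h \<in> carrier G"
  have "AE y in measure_pmf (pmf_of_set {..<N}). y < N"
    using N by (simp add: AE_measure_pmf_iff set_pmf_of_set lessThan_empty_iff)
  then show "AE x in unif N. x h < N"
    unfolding unif_def using h
    by (intro AE_PiM_component) (auto intro: measure_pmf.prob_space_axioms)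
qed

text \<open>Almost surely all values are below \<open>N\<close>, so \<open>P\<close> is almost
  surely covered by the cylinders over the patterns in \<open>Q\<close>. The bound is the sum of
  their measures.\<close>

lemma measure_unif_pattern_le:
  assumes A: "A \<subseteq> carrier G" "finite A" and N: "N > 0" and Q: "finite Q"
    and P: "\<And>x. x \<in> P \<Longrightarrow> (\<And>h. h \<in> carrier G \<Longrightarrow> x h < N) \<Longrightarrow> restrict x A \<in> Q"
  shows "measure (unif N) P \<le> card Q / real N ^ card A"
proof -
  interpret prob_space "unif N" by (rule prob_space_unif)
  have cyl: "{x \<in> space (unif N). \<forall>a \<in> A. x a = v a} \<in> sets (unif N)" for v
  proof -
    have "{x \<in> space (unif N). x a = v a} \<in> sets (unif N)" if "a \<in> A" for a
    proof -
      have "(\<lambda>x. x a) \<in> unif N \<rightarrow>\<^sub>M count_space UNIV"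
        using coordinate_measurable A that measurable_cong_sets[OF sets_unif refl] by blast
      from measurable_sets[OF this, of "{v a}"] show ?thesis
        by (simp add: vimage_def Int_def conj_commute)
    qed
    then show ?thesis using A(2) by (intro sets.sets_Collect_finite_All) auto
  qed
  let ?C = "\<Union>v \<in> Q. {x \<in> space (unif N). \<forall>a \<in> A. x a = v a}"
  have Cm: "?C \<in> sets (unif N)" using Q cyl by (intro sets.finite_UN) auto
  have "AE x in unif N. x \<in> P \<longrightarrow> x \<in> ?C"
    using AE_unif_less[OF N] AE_space
  proof eventually_elim
    case (elim x)
    show ?case
    proof
      assume "x \<in> P"
      then have "restrict x A \<in> Q" using P elim by auto
      then show "x \<in> ?C" using elim(2) by (intro UN_I[of "restrict x A"]) auto
    qed
  qed
  then have "measure (unif N) P \<le> measure (unif N) ?C"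
    using Cm by (rule finite_measure_mono_AE)
  also have "\<dots> \<le> (\<Sum>v \<in> Q. measure (unif N) {x \<in> space (unif N). \<forall>a \<in> A. x a = v a})"
    using Q cyl by (intro finite_measure_subadditive_finite) auto
  also have "\<dots> \<le> (\<Sum>v \<in> Q. 1 / real N ^ card A)"
    using A N by (intro sum_mono measure_unif_cylinder_le)
  finally show ?thesis by simp
qed

section \<open>Almost every point lies in the free part\<close>

text \<open>Greedy choice: an infinite group has an \<open>h\<close> outside \<open>H\<close>,
  \<open>H g\<close> and \<open>H g^-1\<close>. Then \<open>h\<close> avoids the old translate,
  \<open>h g\<close> avoids \<open>H\<close>, and \<open>h g\<close> differs from
  \<open>h\<close>.\<close>

lemma exists_disjoint_translate:
  assumes inf: "infinite (carrier G)" and g: "g \<in> carrier G" "g \<noteq> \<one>"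
  shows "\<exists>H \<subseteq> carrier G. finite H \<and> card H = n \<and> H \<inter> (\<lambda>h. h \<otimes> g) ` H = {}"
proof (induction n)
  case 0
  show ?case by (intro exI[of _ "{}"]) simp
next
  case (Suc n)
  then obtain H where H: "H \<subseteq> carrier G" "finite H" "card H = n" "H \<inter> (\<lambda>h. h \<otimes> g) ` H = {}"
    by blast
  have "finite (H \<union> (\<lambda>h. h \<otimes> g) ` H \<union> (\<lambda>h. h \<otimes> inv g) ` H)" using H by simp
  then obtain h where h: "h \<in> carrier G" "h \<notin> H" "h \<notin> (\<lambda>h. h \<otimes> g) ` H"
      "h \<notin> (\<lambda>h. h \<otimes> inv g) ` H"
    using inf by (metis UnI1 UnI2 finite_subset subsetI)
  have "h \<otimes> g \<notin> H"
  proof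
    assume "h \<otimes> g \<in> H"
    then have "h \<otimes> g \<otimes> inv g \<in> (\<lambda>h. h \<otimes> inv g) ` H" by blast
    then show False using h g by (simp add: m_assoc)
  qed
  moreover have "h \<otimes> g \<noteq> h" using h g by simp
  ultimately have "insert h H \<inter> (\<lambda>h. h \<otimes> g) ` insert h H = {}"
    using H h by auto
  then show ?case using H h by (intro exI[of _ "insert h H"]) auto
qed

text \<open>A point fixed by \<open>g\<close> satisfies \<open>x (h g) = x h\<close> for
  \<open>n\<close> values of \<open>h\<close> whose coordinate pairs are disjoint, which has
  probability at most \<open>N^-n\<close>. As \<open>n\<close> is arbitrary, the fixed points of
  \<open>g\<close> are null, and there are countably many \<open>g\<close>.\<close>

lemma AE_unif_free:
  assumes inf: "infinite (carrier G)" and N: "N \<ge> 2"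
  shows "AE x in unif N. x \<in> free_part G"
proof -
  interpret prob_space "unif N" by (rule prob_space_unif)
  have "AE x in unif N. shift G g x \<noteq> x" if g: "g \<in> carrier G - {\<one>}" for g
  proof -
    let ?P = "{x \<in> space (unif N). shift G g x = x}"
    have le: "measure (unif N) ?P \<le> (1/2) ^ n" for n
    proof -
      obtain H where H: "H \<subseteq> carrier G" "finite H" "card H = n" "H \<inter> (\<lambda>h. h \<otimes> g) ` H = {}"
        using exists_disjoint_translate[OF inf, of g n] g by auto
      define A where "A = H \<union> (\<lambda>h. h \<otimes> g) ` H"
      have A: "A \<subseteq> carrier G" "finite A" using H g by (auto simp: A_def)
      have "inj_on (\<lambda>h. h \<otimes> g) H"
        using H g by (intro inj_onI) (metis r_cancel subsetD DiffD1)
      then have cA: "card A = 2 * n"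
        using H by (simp add: A_def card_Un_disjoint card_image)
      \<comment> \<open>Such a pattern on \<open>A\<close> is determined by its restriction to
        \<open>H\<close>, which leaves at most \<open>N^n\<close> out of \<open>N^(2n)\<close>
        patterns.\<close>
      define Q where "Q = {v \<in> A \<rightarrow>\<^sub>E {..<N}. \<forall>h \<in> H. v (h \<otimes> g) = v h}"
      have Qf: "finite Q" unfolding Q_def using A by (simp add: finite_PiE)
      have "inj_on (\<lambda>v. restrict v H) Q"
      proof (rule inj_onI)
        fix v w assume vw: "v \<in> Q" "w \<in> Q" "restrict v H = restrict w H"
        then have eq: "v h = w h" if "h \<in> H" for h using that by (metis restrict_apply')
        show "v = w"
        proof (rule PiE_ext)
          show "v \<in> A \<rightarrow>\<^sub>E {..<N}" "w \<in> A \<rightarrow>\<^sub>E {..<N}" using vw by (auto simp: Q_def)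
          show "v a = w a" if "a \<in> A" for a
            using that vw eq by (auto simp: A_def Q_def)
        qed
      qed
      moreover have "(\<lambda>v. restrict v H) ` Q \<subseteq> H \<rightarrow>\<^sub>E {..<N}"
        by (auto simp: Q_def A_def PiE_iff)
      ultimately have "card Q \<le> card (H \<rightarrow>\<^sub>E {..<N})"
        using H by (intro card_inj_on_le[of "\<lambda>v. restrict v H"]) (auto intro: finite_PiE)
      then have cQ: "card Q \<le> N ^ n" using H by (simp add: card_PiE)
      have "measure (unif N) ?P \<le> card Q / real N ^ card A"
      proof (rule measure_unif_pattern_le[OF A _ Qf])
        fix x assume x: "x \<in> ?P" and lt: "\<And>h. h \<in> carrier G \<Longrightarrow> x h < N"
        have "x (h \<otimes> g) = x h" if "h \<in> carrier G" for h
          using x shift_apply[OF that, of g x] by simp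
        then show "restrict x A \<in> Q"
          using lt A H by (auto simp: Q_def A_def)
      qed (use N in simp)
      also have "\<dots> \<le> real N ^ n / real N ^ (2 * n)"
        using cQ N unfolding cA by (intro divide_right_mono) (auto simp flip: of_nat_power)
      also have "\<dots> = (1 / real N) ^ n"
        using N by (simp add: power_mult power2_eq_square power_divide mult_2 power_add)
      also have "\<dots> \<le> (1/2) ^ n"
        using N by (intro power_mono) (auto simp: divide_simps)
      finally show ?thesis .
    qed
    have "(\<lambda>n. (1/2::real) ^ n) \<longlonglongrightarrow> 0" by (intro LIMSEQ_power_zero) simp
    then have "measure (unif N) ?P \<le> 0"
      using le by (intro LIMSEQ_le_const[of _ 0]) auto
    then have "measure (unif N) ?P = 0" by (simp add: measure_le_0_iff)
    \<comment> \<open>Nonmeasurable sets get measure 0 by default, so a null set also requires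
      measurability.\<close>
    moreover have "?P \<in> sets (unif N)"
    proof -
      have "?P = {x \<in> space (unif N). \<forall>h \<in> carrier G. x (h \<otimes> g) = x h}"
        by (rule Collect_cong, rule conj_cong[OF refl])
          (auto simp: space_unif shift_def fun_eq_iff PiE_def extensional_def)
      also have "\<dots> \<in> sets (unif N)"
        using countable_carrier coordinate_measurable g measurable_cong_sets[OF sets_unif refl]
        by (intro sets.sets_Collect_countable_All') (auto intro!: measurable_equality_set)
      finally show ?thesis .
    qed
    ultimately have "?P \<in> null_sets (unif N)" by (simp add: null_sets_def emeasure_eq_measure)
    from AE_not_in[OF this] AE_space show ?thesis by eventually_elim auto
  qed
  then have "AE x in unif N. \<forall>g \<in> carrier G - {\<one>}. shift G g x \<noteq> x"
    using countable_carrier by (intro AE_ball_countable') auto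
  then show ?thesis
    using AE_space
    by eventually_elim (auto simp: free_part_def space_unif space_shift_space)
qed

lemma measure_unif_free:
  assumes "infinite (carrier G)" and "N \<ge> 2"
  shows "measure (unif N) (free_part G) = 1"
proof -
  interpret prob_space "unif N" by (rule prob_space_unif)
  have "free_part G \<in> sets (unif N)" by (simp only: sets_unif free_part_sets)
  then show ?thesis using AE_unif_free[OF assms] by (rule prob_eq_1[THEN iffD2])
qed


section \<open>Finite colourings do not separate points\<close>

text \<open>All colours along the orbit determine \<open>x\<close>, hence its value at the identity;
  \<open>finite_determination\<close> reduces them to finitely many up to \<epsilon>. To apply it,
  the measure is moved by \<open>\<rho>\<close> to the Polish space of real sequences.\<close>

lemma finite_coloring_determines_coordinate:
  fixes c :: "('g \<Rightarrow> nat) \<Rightarrow> 'y"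
  assumes inf: "infinite (carrier G)" and N: "N \<ge> 2" and Y: "finite Y"
    and c: "\<And>x. x \<in> free_part G \<Longrightarrow> c x \<in> Y"
    and cm: "\<And>y. y \<in> Y \<Longrightarrow> {x \<in> free_part G. c x = y} \<in> sets (shift_space G)"
    and sep: "\<And>x y. x \<in> free_part G \<Longrightarrow> y \<in> free_part G \<Longrightarrow>
      (\<And>g. g \<in> carrier G \<Longrightarrow> c (shift G g x) = c (shift G g y)) \<Longrightarrow> x = y"
    and \<epsilon>: "\<epsilon> > 0"
  obtains B F where "B \<in> sets (shift_space G)" "B \<subseteq> free_part G" "measure (unif N) B \<ge> 1 - \<epsilon>"
    "finite F" "F \<subseteq> carrier G"
    "\<forall>x \<in> B. \<forall>y \<in> B.
      (\<forall>g \<in> F. c (shift G g x) = c (shift G g y)) \<longrightarrow> x \<one> = y \<one>"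
proof -
  interpret prob_space "unif N" by (rule prob_space_unif)
  define e where "e n = from_nat_into (carrier G) n" for n
  define \<rho> :: "('g \<Rightarrow> nat) \<Rightarrow> nat \<Rightarrow> real" where "\<rho> x = (\<lambda>n. real (x (e n)))" for x
  \<comment> \<open>Rounding makes \<open>\<pi>\<close> a Borel map defined on all real sequences,
    with values in the shift space, and a left inverse of \<open>\<rho>\<close>.\<close>
  define \<pi> :: "(nat \<Rightarrow> real) \<Rightarrow> 'g \<Rightarrow> nat" where
    "\<pi> z = (\<lambda>h \<in> carrier G. nat \<lfloor>z (to_nat_on (carrier G) h)\<rfloor>)" for z
  have e: "e n \<in> carrier G" for n by (simp add: e_def)
  have e_to_nat: "e (to_nat_on (carrier G) h) = h" if "h \<in> carrier G" for h
    using that countable_carrier by (simp add: e_def)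
  have \<pi>\<rho>: "\<pi> (\<rho> x) = x" if "x \<in> carrier G \<rightarrow>\<^sub>E UNIV" for x
    by (rule PiE_ext[OF _ that]) (auto simp: \<pi>_def \<rho>_def e_to_nat)
  have \<pi>_space: "\<pi> z \<in> space (shift_space G)" for z by (simp add: \<pi>_def space_shift_space)
  have \<rho>m: "\<rho> \<in> unif N \<rightarrow>\<^sub>M borel"
  proof (rule measurable_coordinatewise_then_product)
    fix n
    have "(\<lambda>x. x (e n)) \<in> unif N \<rightarrow>\<^sub>M count_space UNIV"
      using coordinate_measurable[OF e] by (subst measurable_cong_sets[OF sets_unif refl])
    then show "(\<lambda>x. \<rho> x n) \<in> borel_measurable (unif N)"
      unfolding \<rho>_def by (rule measurable_compose) simp
  qed
  have \<pi>m: "\<pi> \<in> borel \<rightarrow>\<^sub>M shift_space G"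
    unfolding \<pi>_def shift_space_def
  proof (rule measurable_restrict)
    fix h
    have "(\<lambda>z :: nat \<Rightarrow> real. z (to_nat_on (carrier G) h)) \<in> borel_measurable borel"
      by (rule measurable_product_coordinates)
    then show "(\<lambda>z :: nat \<Rightarrow> real. nat \<lfloor>z (to_nat_on (carrier G) h)\<rfloor>) \<in> borel \<rightarrow>\<^sub>M count_space UNIV"
      by measurable
  qed
  define M where "M = distr (unif N) borel \<rho>"
  define W where "W = \<pi> -` free_part G"
  define f where "f n z = c (shift G (e n) (\<pi> z))" for n z
  define m where "m = to_nat_on (carrier G) \<one>"
  \<comment> \<open>a closed condition satisfied by \<open>(\<rho> x, \<rho> y)\<close> exactly when \<open>x \<one> \<noteq> y \<one>\<close>\<close>
  define D where "D = {p :: (nat \<Rightarrow> real) \<times> (nat \<Rightarrow> real).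
    0 \<le> fst p m \<and> 0 \<le> snd p m \<and> 1 \<le> \<bar>fst p m - snd p m\<bar>}"
  have "finite_measure M"
    unfolding M_def by (intro finite_measure_distr \<rho>m)
  have setsM: "sets M = sets borel" by (simp add: M_def)
  have \<pi>_vimage: "\<pi> -` A \<in> sets M" if "A \<in> sets (shift_space G)" for A
    using measurable_sets[OF \<pi>m that] by (simp add: setsM)
  have W: "W \<in> sets M" unfolding W_def by (intro \<pi>_vimage free_part_sets)
  have fY: "f n z \<in> Y" if "z \<in> W" for n z
    using that c e shift_free_part by (auto simp: f_def W_def)
  have fm: "{z \<in> W. f n z = y} \<in> sets M" if y: "y \<in> Y" for n y
  proof -
    have "{z \<in> W. f n z = y} =
        \<pi> -` (shift G (e n) -` {x \<in> free_part G. c x = y} \<inter> space (shift_space G))"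
      using \<pi>_space shift_free_part_iff[OF _ e] by (auto simp: W_def f_def space_shift_space)
    also have "\<dots> \<in> sets M"
      by (intro \<pi>_vimage measurable_sets[OF shift_measurable] e cm y)
    finally show ?thesis .
  qed
  have D: "closed D"
  proof -
    have c: "continuous_on UNIV (\<lambda>p :: (nat \<Rightarrow> real) \<times> (nat \<Rightarrow> real). fst p m)"
      "continuous_on UNIV (\<lambda>p :: (nat \<Rightarrow> real) \<times> (nat \<Rightarrow> real). snd p m)"
      by (rule continuous_on_compose2[OF continuous_on_product_coordinates];
          force intro: continuous_intros)+
    show ?thesis unfolding D_def
      by (intro closed_Collect_conj closed_Collect_le continuous_intros c)
  qed
  \<comment> \<open>Here \<open>z\<close> and \<open>w\<close> need not be values of
    \<open>\<rho>\<close>. Nonnegative reals at distance at least 1 have different floors; the sign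
    matters because \<open>nat\<close> sends all negative integers to 0.\<close>
  have D_diff: "\<exists>n. f n z \<noteq> f n w" if zw: "z \<in> W" "w \<in> W" "(z, w) \<in> D" for z w
  proof (rule ccontr)
    assume "\<not> ?thesis"
    then have eq: "f n z = f n w" for n by blast
    have "\<pi> z = \<pi> w"
    proof (rule sep)
      fix g assume "g \<in> carrier G"
      then show "c (shift G g (\<pi> z)) = c (shift G g (\<pi> w))"
        using eq[of "to_nat_on (carrier G) g"] by (simp add: f_def e_to_nat)
    qed (use zw in \<open>auto simp: W_def\<close>)
    then have "\<pi> z \<one> = \<pi> w \<one>" by simp
    then have "nat \<lfloor>z m\<rfloor> = nat \<lfloor>w m\<rfloor>" by (simp add: \<pi>_def m_def)
    then show False using zw(3) by (auto simp: D_def) linarith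
  qed
  obtain K l where K: "compact K" "K \<subseteq> W" "measure M (W - K) \<le> \<epsilon>"
    "\<And>z w. z \<in> K \<Longrightarrow> w \<in> K \<Longrightarrow> (z, w) \<in> D \<Longrightarrow> \<exists>n<l. f n z \<noteq> f n w"
    using finite_determination[OF \<open>finite_measure M\<close> setsM Y W fY fm D D_diff \<epsilon>] by blast
  define B where "B = \<rho> -` K \<inter> space (unif N)"
  show thesis
  proof (rule that[of B "e ` {..<l}"])
    have KM: "K \<in> sets M" using K(1) setsM borel_compact by auto
    have Bm: "B \<in> sets (unif N)"
      unfolding B_def using KM setsM by (intro measurable_sets[OF \<rho>m]) simp
    then show "B \<in> sets (shift_space G)" by (simp add: sets_unif)
    have preW: "\<rho> -` W \<inter> space (unif N) = free_part G"
      using \<pi>\<rho> free_partD by (auto simp: W_def space_unif)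
    then show BX: "B \<subseteq> free_part G" using K(2) by (auto simp: B_def)
    have "free_part G - B = \<rho> -` (W - K) \<inter> space (unif N)"
      using preW by (auto simp: B_def)
    then have "measure (unif N) (free_part G - B) = measure M (W - K)"
      unfolding M_def using W KM setsM by (subst measure_distr[OF \<rho>m]) auto
    then have "measure (unif N) (free_part G) - measure (unif N) B \<le> \<epsilon>"
      using K(3) BX Bm free_part_sets sets_unif by (subst finite_measure_Diff[symmetric]) auto
    then show "measure (unif N) B \<ge> 1 - \<epsilon>"
      using measure_unif_free[OF inf N] by simp
    show "e ` {..<l} \<subseteq> carrier G" using e by auto
    show "\<forall>x \<in> B. \<forall>y \<in> B.
        (\<forall>g \<in> e ` {..<l}. c (shift G g x) = c (shift G g y)) \<longrightarrow> x \<one> = y \<one>"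
    proof (intro ballI impI)
      fix x y assume xy: "x \<in> B" "y \<in> B"
        and eq: "\<forall>g \<in> e ` {..<l}. c (shift G g x) = c (shift G g y)"
      have sp: "x \<in> carrier G \<rightarrow>\<^sub>E UNIV" "y \<in> carrier G \<rightarrow>\<^sub>E UNIV"
        using xy BX free_partD by auto
      have "f n (\<rho> x) = f n (\<rho> y)" if "n < l" for n
        using eq that sp by (simp add: f_def \<pi>\<rho>)
      then have "(\<rho> x, \<rho> y) \<notin> D" using K(4)[of "\<rho> x" "\<rho> y"] xy by (auto simp: B_def)
      then show "x \<one> = y \<one>"
        by (auto simp: D_def \<rho>_def m_def e_to_nat)
    qed
  qed simp
qed

section \<open>Foelner sets, returns to a large set, and counting patterns\<close>

text \<open>\<open>F A\<close> is covered by \<open>A\<close> and the parts of the translates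
  \<open>g A\<close> outside \<open>A\<close>. For a Foelner set that is nearly invariant under each
  \<open>g\<close> in \<open>F\<close>, these parts together have at most \<open>card A\<close>
  elements.\<close>

lemma amenable_small_boundary:
  assumes am: "amenable G" and F: "finite F" "F \<subseteq> carrier G"
  obtains A where "finite A" "A \<noteq> {}" "A \<subseteq> carrier G"
    "card ((\<lambda>(f, a). f \<otimes> a) ` (F \<times> A)) \<le> 2 * card A"
proof -
  obtain \<Phi> :: "nat \<Rightarrow> 'g set" where \<Phi>: "\<And>m. \<Phi> m \<subseteq> carrier G \<and> finite (\<Phi> m) \<and> \<Phi> m \<noteq> {}"
    and lim: "\<And>g. g \<in> carrier G \<Longrightarrow>
      (\<lambda>m. real (card (sym_diff (g <# \<Phi> m) (\<Phi> m))) / real (card (\<Phi> m))) \<longlonglongrightarrow> 0"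
    using am unfolding amenable_def by blast
  define \<delta> where "\<delta> = 1 / (real (card F) + 1)"
  have "\<delta> > 0" by (simp add: \<delta>_def)
  have "\<forall>\<^sub>F m in sequentially. \<forall>g \<in> F.
      real (card (sym_diff (g <# \<Phi> m) (\<Phi> m))) / real (card (\<Phi> m)) < \<delta>"
    using F lim \<open>\<delta> > 0\<close> by (intro eventually_ball_finite ballI order_tendstoD(2)) auto
  then obtain m where m: "\<And>g. g \<in> F \<Longrightarrow>
      real (card (sym_diff (g <# \<Phi> m) (\<Phi> m))) / real (card (\<Phi> m)) < \<delta>"
    using eventually_happens by fastforce
  define A where "A = \<Phi> m"
  have A: "finite A" "A \<noteq> {}" "A \<subseteq> carrier G" using \<Phi>[of m] by (auto simp: A_def)
  have cA: "card A > 0" using A by (simp add: card_gt_0_iff)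
  have "(\<lambda>(f, a). f \<otimes> a) ` (F \<times> A) \<subseteq> A \<union> (\<Union>g \<in> F. (g <# A) - A)"
    by (auto simp: l_coset_def)
  moreover have fin: "finite (g <# A)" for g using A by (auto simp: l_coset_def)
  ultimately have "card ((\<lambda>(f, a). f \<otimes> a) ` (F \<times> A)) \<le> card (A \<union> (\<Union>g \<in> F. (g <# A) - A))"
    using A F by (intro card_mono) auto
  also have "\<dots> \<le> card A + card (\<Union>g \<in> F. (g <# A) - A)" by (rule card_Un_le)
  also have "\<dots> \<le> card A + (\<Sum>g \<in> F. card ((g <# A) - A))"
    using F by (intro add_left_mono card_UN_le)
  finally have "real (card ((\<lambda>(f, a). f \<otimes> a) ` (F \<times> A))) \<le>
      real (card A) + (\<Sum>g \<in> F. real (card ((g <# A) - A)))"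
    by (simp flip: of_nat_sum of_nat_add)
  also have "(\<Sum>g \<in> F. real (card ((g <# A) - A))) \<le> (\<Sum>g \<in> F. \<delta> * card A)"
  proof (rule sum_mono)
    fix g assume "g \<in> F"
    have "card ((g <# A) - A) \<le> card (sym_diff (g <# A) A)"
      using A fin by (intro card_mono) auto
    moreover have "real (card (sym_diff (g <# A) A)) \<le> \<delta> * card A"
      using m[OF \<open>g \<in> F\<close>] cA by (simp add: A_def[symmetric] divide_simps)
    ultimately show "real (card ((g <# A) - A)) \<le> \<delta> * card A" by linarith
  qed
  also have "(\<Sum>g \<in> F. \<delta> * card A) \<le> card A"
    by (simp add: \<delta>_def field_simps)
  finally have "card ((\<lambda>(f, a). f \<otimes> a) ` (F \<times> A)) \<le> 2 * card A" by linarith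
  then show thesis using A that by blast
qed

text \<open>By invariance each \<open>a x\<close> misses \<open>B\<close> with probability at most
  1/8, so the expected number of misses is at most \<open>card A / 8\<close>. Markov's inequality
  bounds the probability of at least \<open>card A / 2\<close> misses by 1/4.\<close>

lemma measure_unif_many_returns:
  assumes A: "finite A" "A \<noteq> {}" "A \<subseteq> carrier G"
    and B: "B \<in> sets (shift_space G)" "measure (unif N) B \<ge> 7/8"
  shows "measure (unif N) {x \<in> space (unif N). 2 * card {a \<in> A. shift G a x \<notin> B} \<le> card A} \<ge> 3/4"
proof -
  interpret prob_space "unif N" by (rule prob_space_unif)
  define V where "V a = {x \<in> space (unif N). shift G a x \<notin> B}" for a
  have Bm: "B \<in> sets (unif N)" using B by (simp add: sets_unif)
  have V: "V a \<in> sets (unif N)" "measure (unif N) (V a) \<le> 1/8" if a: "a \<in> A" for a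
  proof -
    have ac: "a \<in> carrier G" using a A by auto
    have pre: "{x \<in> space (unif N). shift G a x \<in> B} \<in> sets (unif N)"
      using measurable_sets[OF shift_measurable_unif[OF ac] Bm]
      by (simp add: vimage_def Int_def conj_commute)
    have Veq: "V a = space (unif N) - {x \<in> space (unif N). shift G a x \<in> B}" by (auto simp: V_def)
    show "V a \<in> sets (unif N)" unfolding Veq using pre by (intro sets.compl_sets)
    show "measure (unif N) (V a) \<le> 1/8"
      unfolding Veq using prob_compl[OF pre] measure_unif_shift[OF ac Bm] B(2) by simp
  qed
  define u where "u x = (\<Sum>a \<in> A. indicator (V a) x :: real)" for x
  have u: "u x = card {a \<in> A. shift G a x \<notin> B}" if "x \<in> space (unif N)" for x
    using A that by (simp add: u_def V_def indicator_def sum.If_cases Int_def flip: of_bool_def)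
  have int: "integrable (unif N) u"
    unfolding u_def using V by (intro Bochner_Integration.integrable_sum) (auto simp: integrable_indicator_iff emeasure_eq_measure)
  have cA: "real (card A) > 0" using A by (simp add: card_gt_0_iff)
  have "expectation u = (\<Sum>a \<in> A. measure (unif N) (V a))"
    unfolding u_def using V by (subst Bochner_Integration.integral_sum) (auto simp: emeasure_eq_measure)
  also have "\<dots> \<le> (\<Sum>a \<in> A. 1/8)" using V by (intro sum_mono)
  finally have E: "expectation u \<le> card A / 8" by simp
  have um: "u \<in> borel_measurable (unif N)" using int by auto
  have unn: "0 \<le> u x" for x by (simp add: u_def sum_nonneg)
  let ?P = "{x \<in> space (unif N). real (card A) / 2 \<le> u x}"
  have Pm: "?P \<in> sets (unif N)" using um by measurable
  have "measure (unif N) ?P \<le> expectation u / (real (card A) / 2)"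
    using int cA unn by (intro integral_Markov_inequality_measure[where A = "{}"]) auto
  also have "\<dots> \<le> (card A / 8) / (real (card A) / 2)"
    using E cA by (intro divide_right_mono) auto
  also have "\<dots> = 1/4" using cA by simp
  finally have "3/4 \<le> measure (unif N) (space (unif N) - ?P)"
    using prob_compl[OF Pm] by simp
  also have "\<dots> \<le> measure (unif N) {x \<in> space (unif N). u x \<le> real (card A) / 2}"
    using um by (intro finite_measure_mono) (auto, measurable)
  also have "{x \<in> space (unif N). u x \<le> real (card A) / 2} =
      {x \<in> space (unif N). 2 * card {a \<in> A. shift G a x \<notin> B} \<le> card A}"
    by (rule Collect_cong, rule conj_cong[OF refl]) (auto simp: u)
  finally show ?thesis .
qed

text \<open>If \<open>F\<close>-many colours determine a coordinate on \<open>B\<close>, then a configuration on \<open>A\<close> is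
  determined by the set of returns to \<open>B\<close>, the colours on \<open>F A\<close>, and its values at the few
  non-returning places.\<close>

lemma card_patterns_le:
  fixes c :: "('g \<Rightarrow> nat) \<Rightarrow> 'y"
  assumes A: "finite A" "A \<subseteq> carrier G"
    and F: "finite F" "F \<subseteq> carrier G" "card ((\<lambda>(f, a). f \<otimes> a) ` (F \<times> A)) \<le> 2 * card A"
    and Y: "finite Y" "card Y \<le> k" "k > 0" and L: "L > 0"
    and c: "\<And>x. x \<in> free_part G \<Longrightarrow> c x \<in> Y"
    and B: "\<forall>x \<in> B. \<forall>y \<in> B.
      (\<forall>g \<in> F. c (shift G g x) = c (shift G g y)) \<longrightarrow> x \<one> = y \<one>"
  defines "P \<equiv> {x \<in> free_part G. 2 * card {a \<in> A. shift G a x \<notin> B} \<le> card A \<and>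
      (\<forall>h \<in> carrier G. x h < L\<^sup>2)}"
  shows "finite ((\<lambda>x. restrict x A) ` P)"
    and "card ((\<lambda>x. restrict x A) ` P) \<le> (2 * k\<^sup>2 * L) ^ card A"
proof -
  define FA where "FA = (\<lambda>(f, a). f \<otimes> a) ` (F \<times> A)"
  have FA: "finite FA" "FA \<subseteq> carrier G" using A F by (auto simp: FA_def)
  define R where "R x = {a \<in> A. shift G a x \<notin> B}" for x
  define code where "code x = (R x, \<lambda>b \<in> FA. c (shift G b x), restrict x (R x))" for x
  define \<T> where "\<T> = {T \<in> Pow A. 2 * card T \<le> card A}"
  define \<C> where "\<C> = (SIGMA T : \<T>. (FA \<rightarrow>\<^sub>E Y) \<times> (T \<rightarrow>\<^sub>E {..<L\<^sup>2}))"
  have T: "finite \<T>" "\<And>T. T \<in> \<T> \<Longrightarrow> finite T"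
    using A by (auto simp: \<T>_def intro: finite_subset)
  have C: "finite \<C>"
    unfolding \<C>_def using T FA Y by (intro finite_SigmaI finite_cartesian_product finite_PiE) auto
  have "card \<C> = (\<Sum>T \<in> \<T>. card Y ^ card FA * (L\<^sup>2) ^ card T)"
    unfolding \<C>_def using T FA Y by (subst card_SigmaI) (auto simp: card_cartesian_product card_PiE finite_PiE)
  also have "\<dots> \<le> (\<Sum>T \<in> \<T>. k ^ (2 * card A) * L ^ card A)"
  proof (rule sum_mono)
    fix T assume "T \<in> \<T>"
    have "card Y ^ card FA \<le> k ^ card FA" using Y by (intro power_mono) auto
    also have "\<dots> \<le> k ^ (2 * card A)" using F Y by (intro power_increasing) (auto simp: FA_def)
    finally have "card Y ^ card FA \<le> k ^ (2 * card A)" .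
    \<comment> \<open>The alphabet size is a square so that \<open>2 * card T \<le> card A\<close>
      halves the exponent without roots or rounding.\<close>
    moreover have "(L\<^sup>2) ^ card T \<le> L ^ card A"
      unfolding power_mult[symmetric] using \<open>T \<in> \<T>\<close> L by (intro power_increasing) (auto simp: \<T>_def)
    ultimately show "card Y ^ card FA * (L\<^sup>2) ^ card T \<le> k ^ (2 * card A) * L ^ card A"
      by (rule mult_mono) auto
  qed
  also have "\<dots> \<le> 2 ^ card A * (k ^ (2 * card A) * L ^ card A)"
  proof -
    have "card \<T> \<le> card (Pow A)" using A by (intro card_mono) (auto simp: \<T>_def)
    then show ?thesis using A by (simp add: card_Pow)
  qed
  also have "\<dots> = (2 * k\<^sup>2 * L) ^ card A" by (simp add: power_mult_distrib power_mult)
  finally have cC: "card \<C> \<le> (2 * k\<^sup>2 * L) ^ card A" .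
  have sub: "code ` P \<subseteq> \<C>"
  proof (rule image_subsetI)
    fix x assume x: "x \<in> P"
    have "R x \<subseteq> A" by (auto simp: R_def)
    then show "code x \<in> \<C>"
      using x A FA c shift_free_part
      by (auto simp: code_def \<C>_def \<T>_def P_def R_def subset_iff)
  qed
  have fin: "finite (code ` P)" using sub C by (rule finite_subset)
  have det: "restrict x A = restrict y A" if xy: "x \<in> P" "y \<in> P" "code x = code y" for x y
  proof (rule restrict_ext)
    fix a assume a: "a \<in> A"
    have ac: "a \<in> carrier G" using a A by auto
    have R_eq: "R x = R y" and col_eq: "(\<lambda>b \<in> FA. c (shift G b x)) = (\<lambda>b \<in> FA. c (shift G b y))"
      and val_eq: "restrict x (R x) = restrict y (R y)"
      using xy(3) unfolding code_def prod.inject by blast+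
    show "x a = y a"
    proof (cases "a \<in> R x")
      case True
      then show ?thesis using fun_cong[OF val_eq, of a] R_eq by simp
    next
      case False
      have eq: "c (shift G b x) = c (shift G b y)" if "b \<in> FA" for b
        using fun_cong[OF col_eq, of b] that by simp
      have "shift G a x \<in> B" "shift G a y \<in> B" using False a R_eq by (auto simp: R_def)
      \<comment> \<open>Since \<open>g (a x) = (g a) x\<close>, the colours that \<open>F\<close>
        reads from \<open>a x\<close> are among those recorded on \<open>FA\<close>.\<close>
      moreover have "c (shift G g (shift G a x)) = c (shift G g (shift G a y))" if "g \<in> F" for g
        using eq[of "g \<otimes> a"] that a ac F by (auto simp: shift_mult FA_def subset_iff)
      ultimately have "shift G a x \<one> = shift G a y \<one>" using B by blast
      then show ?thesis using ac by (simp add: shift_apply)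
    qed
  qed
  have "(\<lambda>x. restrict x A) ` P \<subseteq> A \<rightarrow>\<^sub>E {..<L\<^sup>2}"
    using A by (auto simp: P_def)
  then show "finite ((\<lambda>x. restrict x A) ` P)"
    by (rule finite_subset) (intro finite_PiE A(1) finite_lessThan)
  have "card ((\<lambda>x. restrict x A) ` P) \<le> card (code ` P)"
    using fin det by (rule card_image_le_of_factor)
  also have "\<dots> \<le> card \<C>" using C sub by (rule card_mono)
  finally show "card ((\<lambda>x. restrict x A) ` P) \<le> (2 * k\<^sup>2 * L) ^ card A" using cC by linarith
qed

text \<open>If orbit colours separated points, the points returning often to \<open>B\<close> would
  have measure at least 3/4, while counting their patterns on \<open>A\<close> bounds that measure
  by \<open>(2/5) ^ card A\<close>.\<close>

lemma finite_coloring_not_separating: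
  fixes c :: "('g \<Rightarrow> nat) \<Rightarrow> 'y"
  assumes inf: "infinite (carrier G)" and am: "amenable G" and Y: "finite Y"
    and c: "\<And>x. x \<in> free_part G \<Longrightarrow> c x \<in> Y"
    and cm: "\<And>y. y \<in> Y \<Longrightarrow> {x \<in> free_part G. c x = y} \<in> sets (shift_space G)"
  shows "\<exists>x \<in> free_part G. \<exists>y \<in> free_part G. x \<noteq> y \<and>
    (\<forall>g \<in> carrier G. c (shift G g x) = c (shift G g y))"
proof (rule ccontr)
  assume "\<not> ?thesis"
  then have sep: "x = y" if "x \<in> free_part G" "y \<in> free_part G"
    "\<And>g. g \<in> carrier G \<Longrightarrow> c (shift G g x) = c (shift G g y)" for x y
    using that by blast
  \<comment> \<open>The successor keeps \<open>k\<close> positive even for empty \<open>Y\<close>.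
    With alphabet size \<open>L^2\<close>, the share of admissible patterns is
    \<open>(2 k^2 / L) ^ card A\<close>, and the factor 5 makes its base 2/5.\<close>
  define k where "k = Suc (card Y)"
  define L where "L = 5 * k\<^sup>2"
  have k: "k > 0" "card Y \<le> k" by (auto simp: k_def)
  have L: "L > 0" using k by (simp add: L_def)
  have "1 \<le> k\<^sup>2" using k by simp
  then have "5 \<le> L" by (simp add: L_def)
  then have N: "L\<^sup>2 \<ge> 2" using self_le_power[of L 2] by simp
  interpret prob_space "unif (L\<^sup>2)" by (rule prob_space_unif)
  have "(1/8 :: real) > 0" by simp
  obtain B F where B: "B \<in> sets (shift_space G)" "B \<subseteq> free_part G"
      "measure (unif (L\<^sup>2)) B \<ge> 1 - 1/8"
    and F: "finite F" "F \<subseteq> carrier G"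
    and det: "\<forall>x \<in> B. \<forall>y \<in> B.
      (\<forall>g \<in> F. c (shift G g x) = c (shift G g y)) \<longrightarrow> x \<one> = y \<one>"
    by (rule finite_coloring_determines_coordinate[OF inf N Y c cm sep \<open>1/8 > 0\<close>]) blast+
  obtain A where A: "finite A" "A \<noteq> {}" "A \<subseteq> carrier G"
    "card ((\<lambda>(f, a). f \<otimes> a) ` (F \<times> A)) \<le> 2 * card A"
    using amenable_small_boundary[OF am F] by blast
  have cA: "card A > 0" using A by (simp add: card_gt_0_iff)
  define H where "H = {x \<in> space (unif (L\<^sup>2)). 2 * card {a \<in> A. shift G a x \<notin> B} \<le> card A}"
  have "3/4 \<le> measure (unif (L\<^sup>2)) H"
    unfolding H_def using A B by (intro measure_unif_many_returns) auto
  also have "\<dots> = measure (unif (L\<^sup>2)) (H \<inter> free_part G)"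
  proof (rule finite_measure_eq_AE)
    show "AE x in unif (L\<^sup>2). x \<in> H \<longleftrightarrow> x \<in> H \<inter> free_part G"
      using AE_unif_free[OF inf N] by eventually_elim auto
    \<comment> \<open>A set outside the sigma-algebra would have measure 0, contrary to the lower
      bound 3/4.\<close>
    have "H \<in> sets (unif (L\<^sup>2))"
      using \<open>3/4 \<le> measure (unif (L\<^sup>2)) H\<close> measure_notin_sets by fastforce
    then show "H \<in> sets (unif (L\<^sup>2))" "H \<inter> free_part G \<in> sets (unif (L\<^sup>2))"
      using free_part_sets by (auto simp: sets_unif)
  qed
  also have "\<dots> \<le> (2 * k\<^sup>2 * L) ^ card A / real (L\<^sup>2) ^ card A"
  proof -
    define P where "P = {x \<in> free_part G. 2 * card {a \<in> A. shift G a x \<notin> B} \<le> card A \<and>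
      (\<forall>h \<in> carrier G. x h < L\<^sup>2)}"
    note pat = card_patterns_le[where c = c and B = B, OF A(1,3) F A(4) Y k(2,1) L c det, folded P_def]
    have "measure (unif (L\<^sup>2)) (H \<inter> free_part G) \<le>
        card ((\<lambda>x. restrict x A) ` P) / real (L\<^sup>2) ^ card A"
      using A N pat(1) by (intro measure_unif_pattern_le) (auto simp: H_def P_def)
    also have "\<dots> \<le> (2 * k\<^sup>2 * L) ^ card A / real (L\<^sup>2) ^ card A"
      using pat(2) by (intro divide_right_mono) (auto simp flip: of_nat_power)
    finally show ?thesis .
  qed
  also have "\<dots> = (2/5) ^ card A"
    using k by (simp add: L_def power2_eq_square flip: power_divide)
  also have "\<dots> \<le> (2/5) ^ 1" using cA by (intro power_decreasing) auto
  finally show False by simp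
qed

end

section \<open>Combining the upper and the lower bound\<close>

theorem corollary6p3:
  fixes G :: "('g, 'm) monoid_scheme" and S :: "'g set"
  assumes "group G"
    and "countable (carrier G)" and "infinite (carrier G)"
    and "amenable G"
    and "S \<subseteq> carrier G" and "finite S" and "generate G S = carrier G"
    and "\<forall>s \<in> S. inv\<^bsub>G\<^esub> s \<in> S" and "\<one>\<^bsub>G\<^esub> \<notin> S"
  shows "borel_distinguishing_number (free_shift G) (schreier_graph G S) =o natLeq"
proof -
  interpret countable_group G
    using assms by (simp add: countable_group_def countable_group_axioms_def)
  define M where "M = free_shift G"
  define E where "E = schreier_graph G S"
  obtain c0 where c0: "borel_distinguishing_coloring M E (count_space (UNIV :: nat set)) c0"
    unfolding M_def E_def using countable_distinguishing_coloring assms by blast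
  have "borel_distinguishing_number M E \<le>o |UNIV :: nat set|"
    using borel_distinguishing_number_le[OF c0] by simp
  then have le: "borel_distinguishing_number M E \<le>o natLeq"
    using card_of_nat ordLeq_ordIso_trans by blast
  have "borel_distinguishing_number M E \<in> distinguishing_cardinals M E"
    using distinguishing_cardinals_of_coloring[OF c0] borel_distinguishing_number_minimum(1) by blast
  then obtain Y :: "real measure" and c where Y: "borel_distinguishing_number M E = |space Y|"
    and c: "borel_distinguishing_coloring M E Y c"
    unfolding distinguishing_cardinals_def by blast
  have cY: "c \<in> M \<rightarrow>\<^sub>M Y" and sbY: "standard_borel Y"
    using c by (auto simp: borel_distinguishing_coloring_def)
  have "infinite (space Y)"
  proof
    assume fin: "finite (space Y)"
    have "c x \<in> space Y" if "x \<in> free_part G" for x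
      using measurable_space[OF cY] that by (simp add: M_def space_free_shift)
    \<comment> \<open>Singletons of \<open>Y\<close> are measurable, so colour classes are
      measurable in the free part, and hence in the whole shift space because the free part is
      measurable there.\<close>
    moreover have "{x \<in> free_part G. c x = y} \<in> sets (shift_space G)" if "y \<in> space Y" for y
    proof -
      have "{x \<in> free_part G. c x = y} = c -` {y} \<inter> space M"
        by (auto simp: M_def space_free_shift)
      also have "\<dots> \<in> sets M"
        using cY standard_borel_singleton[OF sbY that] by (rule measurable_sets)
      finally show ?thesis
        using free_part_sets by (auto simp: M_def free_shift_def sets_restrict_space)
    qed
    ultimately obtain x y where "x \<in> free_part G" "y \<in> free_part G" "x \<noteq> y"
      "\<forall>g \<in> carrier G. c (shift G g x) = c (shift G g y)"
      using finite_coloring_not_separating[OF assms(3,4) fin, of c] by blast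
    then show False
      using distinguishing_separates[of S Y c x y] assms(5,9) c unfolding M_def E_def by blast
  qed
  then have "natLeq \<le>o borel_distinguishing_number M E"
    unfolding Y using infinite_iff_natLeq_ordLeq by blast
  then show ?thesis
    using le unfolding M_def E_def by (simp add: ordIso_iff_ordLeq)
qed

end
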